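(* An algebra $A\in\mathsf{G^*A}$ is $c^*$-compact (in $\mathsf{G^*A}$) if and only if the reflection $\alpha_A=\eta_A:A\to C^*(A)$ is surjective.
   Context: A $*$-algebra is a complex algebra with an involution $a\mapsto a^*$ satisfying $(a+\lambda b)^*=a^*+\bar\lambda b^*$ and $(ab)^*=b^*a^*$. A topological $*$-algebra is a $*$-algebra with a topology making addition, multiplication, additive inverse and involution jointly continuous; $\mathsf{T^*A}$ is the category of topological $*$-algebras and continuous $*$-homomorphisms; subobjects are $*$-subalgebras with the subspace topology. A $C^*$-seminorm on $A$ is a seminorm $p$ with $p(ab)\le p(a)p(b)$ and $p(a^*a)=p(a)^2$. $\mathcal N(A)$ is the set of continuous $C^*$-seminorms on $A$, directed pointwise. For $p\in\mathcal N(A)$, $A_p$ is the completion of $A/\ker p$ with respect to the $C^*$-norm induced by $p$. $\mathcal T_A$ (the $*$-representation topology) is the initial topology on $A$ induced by $\mathcal N(A)$; for a $*$-subalgebra $S\subseteq A$, $c^*_A(S)$ is the closure of $S$ in $\mathcal T_A$. $\mathsf{G^*A}$ is the full subcategory of $\mathsf{T^*A}$ of algebras $A$ for which $\mathcal N(A)$ has a largest element $r$; for such $A$, the enveloping $C^*$-algebra is $C^*(A):=\lim_{p\in\mathcal N(A)}A_p\cong A_r$, and $\eta_A:A\to C^*(A)$, $\eta_A(x)=(x+\ker p)_p$, is the reflection of $A$ into the category of $C^*$-algebras. $A\in\mathsf{G^*A}$ is $c^*$-compact (in $\mathsf{G^*A}$) if for every $B\in\mathsf{G^*A}$ and every $*$-subalgebra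 $S\subseteq A\times B$, $\pi_B(c^*_{A\times B}(S))=c^*_B(\pi_B(S))$, where $\pi_B:A\times B\to B$ is the projection. *)

theory Defs
  imports "HOL-Analysis.Analysis"
begin

record 'a tsalg =
  sa_carrier :: "'a set"
  sa_add :: "'a \<Rightarrow> 'a \<Rightarrow> 'a"
  sa_mul :: "'a \<Rightarrow> 'a \<Rightarrow> 'a"
  sa_smul :: "complex \<Rightarrow> 'a \<Rightarrow> 'a"
  sa_zero :: 'a
  sa_star :: "'a \<Rightarrow> 'a"
  sa_top :: "'a topology"

definition sa_neg :: "'a tsalg \<Rightarrow> 'a \<Rightarrow> 'a" where
  "sa_neg A x = sa_smul A (-1) x"

definition sa_diff :: "'a tsalg \<Rightarrow> 'a \<Rightarrow> 'a \<Rightarrow> 'a" where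
  "sa_diff A x y = sa_add A x (sa_neg A y)"

definition star_algebra :: "'a tsalg \<Rightarrow> bool" where
  "star_algebra A \<longleftrightarrow>
    (let C = sa_carrier A; add = sa_add A; mul = sa_mul A; sm = sa_smul A;
         z = sa_zero A; st = sa_star A in
     z \<in> C \<and>
     (\<forall>x\<in>C. \<forall>y\<in>C. add x y \<in> C) \<and>
     (\<forall>x\<in>C. \<forall>y\<in>C. mul x y \<in> C) \<and>
     (\<forall>c. \<forall>x\<in>C. sm c x \<in> C) \<and>
     (\<forall>x\<in>C. st x \<in> C) \<and>
     \<comment> \<open>complex vector space\<close>
     (\<forall>x\<in>C. \<forall>y\<in>C. \<forall>w\<in>C. add (add x y) w = add x (add y w)) \<and>
     (\<forall>x\<in>C. \<forall>y\<in>C. add x y = add y x) \<and>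
     (\<forall>x\<in>C. add z x = x) \<and>
     (\<forall>x\<in>C. add x (sm (-1) x) = z) \<and>
     (\<forall>c. \<forall>x\<in>C. \<forall>y\<in>C. sm c (add x y) = add (sm c x) (sm c y)) \<and>
     (\<forall>c d. \<forall>x\<in>C. sm (c + d) x = add (sm c x) (sm d x)) \<and>
     (\<forall>c d. \<forall>x\<in>C. sm (c * d) x = sm c (sm d x)) \<and>
     (\<forall>x\<in>C. sm 1 x = x) \<and>
     \<comment> \<open>associative algebra\<close>
     (\<forall>x\<in>C. \<forall>y\<in>C. \<forall>w\<in>C. mul (mul x y) w = mul x (mul y w)) \<and>
     (\<forall>x\<in>C. \<forall>y\<in>C. \<forall>w\<in>C. mul x (add y w) = add (mul x y) (mul x w)) \<and>
     (\<forall>x\<in>C. \<forall>y\<in>C. \<forall>w\<in>C. mul (add x y) w = add (mul x w) (mul y w)) \<and>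
     (\<forall>c. \<forall>x\<in>C. \<forall>y\<in>C. sm c (mul x y) = mul (sm c x) y \<and> sm c (mul x y) = mul x (sm c y)) \<and>
     \<comment> \<open>involution\<close>
     (\<forall>x\<in>C. \<forall>y\<in>C. st (add x y) = add (st x) (st y)) \<and>
     (\<forall>c. \<forall>x\<in>C. st (sm c x) = sm (cnj c) (st x)) \<and>
     (\<forall>x\<in>C. \<forall>y\<in>C. st (mul x y) = mul (st y) (st x)) \<and>
     (\<forall>x\<in>C. st (st x) = x))"

text \<open>Topological *-algebra: addition, multiplication, additive inverse and
  involution jointly continuous (scalar multiplication is not required to be).\<close>
definition top_star_algebra :: "'a tsalg \<Rightarrow> bool" where
  "top_star_algebra A \<longleftrightarrow> star_algebra A \<and>
     topspace (sa_top A) = sa_carrier A \<and>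
     continuous_map (prod_topology (sa_top A) (sa_top A)) (sa_top A) (\<lambda>(x, y). sa_add A x y) \<and>
     continuous_map (prod_topology (sa_top A) (sa_top A)) (sa_top A) (\<lambda>(x, y). sa_mul A x y) \<and>
     continuous_map (sa_top A) (sa_top A) (sa_neg A) \<and>
     continuous_map (sa_top A) (sa_top A) (sa_star A)"

definition star_subalgebra :: "'a tsalg \<Rightarrow> 'a set \<Rightarrow> bool" where
  "star_subalgebra A S \<longleftrightarrow> S \<subseteq> sa_carrier A \<and> sa_zero A \<in> S \<and>
     (\<forall>x\<in>S. \<forall>y\<in>S. sa_add A x y \<in> S) \<and>
     (\<forall>x\<in>S. \<forall>y\<in>S. sa_mul A x y \<in> S) \<and>
     (\<forall>c. \<forall>x\<in>S. sa_smul A c x \<in> S) \<and>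
     (\<forall>x\<in>S. sa_star A x \<in> S)"

definition cstar_seminorm :: "'a tsalg \<Rightarrow> ('a \<Rightarrow> real) \<Rightarrow> bool" where
  "cstar_seminorm A p \<longleftrightarrow>
     (\<forall>x\<in>sa_carrier A. 0 \<le> p x) \<and>
     (\<forall>c. \<forall>x\<in>sa_carrier A. p (sa_smul A c x) = cmod c * p x) \<and>
     (\<forall>x\<in>sa_carrier A. \<forall>y\<in>sa_carrier A. p (sa_add A x y) \<le> p x + p y) \<and>
     (\<forall>x\<in>sa_carrier A. \<forall>y\<in>sa_carrier A. p (sa_mul A x y) \<le> p x * p y) \<and>
     (\<forall>x\<in>sa_carrier A. p (sa_mul A (sa_star A x) x) = (p x)\<^sup>2)"

text \<open>\<open>\<N>(A)\<close>: continuous C*-seminorms, taken extensional (zero off the carrier)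
  so that the pointwise order is a partial order.\<close>
definition cont_cstar_seminorms :: "'a tsalg \<Rightarrow> ('a \<Rightarrow> real) set" where
  "cont_cstar_seminorms A = {p. cstar_seminorm A p \<and>
      continuous_map (sa_top A) euclideanreal p \<and>
      (\<forall>x. x \<notin> sa_carrier A \<longrightarrow> p x = 0)}"

definition is_largest_seminorm :: "'a tsalg \<Rightarrow> ('a \<Rightarrow> real) \<Rightarrow> bool" where
  "is_largest_seminorm A r \<longleftrightarrow> r \<in> cont_cstar_seminorms A \<and>
     (\<forall>p\<in>cont_cstar_seminorms A. \<forall>x. p x \<le> r x)"

definition in_GsA :: "'a tsalg \<Rightarrow> bool" where
  "in_GsA A \<longleftrightarrow> top_star_algebra A \<and> (\<exists>r. is_largest_seminorm A r)"

definition largest_seminorm :: "'a tsalg \<Rightarrow> 'a \<Rightarrow> real" where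
  "largest_seminorm A = (THE r. is_largest_seminorm A r)"

definition rep_topology :: "'a tsalg \<Rightarrow> 'a topology" where
  "rep_topology A = topology_generated_by
     {{y \<in> sa_carrier A. p (sa_diff A y x) < e} | p x e.
        p \<in> cont_cstar_seminorms A \<and> x \<in> sa_carrier A \<and> e > 0}"

definition cstar_closure :: "'a tsalg \<Rightarrow> 'a set \<Rightarrow> 'a set" where
  "cstar_closure A S = (rep_topology A) closure_of S"

definition sa_prod :: "'a tsalg \<Rightarrow> 'b tsalg \<Rightarrow> ('a \<times> 'b) tsalg" where
  "sa_prod A B = \<lparr> sa_carrier = sa_carrier A \<times> sa_carrier B,
     sa_add = (\<lambda>(a, b) (a', b'). (sa_add A a a', sa_add B b b')),
     sa_mul = (\<lambda>(a, b) (a', b'). (sa_mul A a a', sa_mul B b b')),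
     sa_smul = (\<lambda>c (a, b). (sa_smul A c a, sa_smul B c b)),
     sa_zero = (sa_zero A, sa_zero B),
     sa_star = (\<lambda>(a, b). (sa_star A a, sa_star B b)),
     sa_top = prod_topology (sa_top A) (sa_top B) \<rparr>"

definition cstar_compact :: "'b itself \<Rightarrow> 'a tsalg \<Rightarrow> bool" where
  "cstar_compact (_ :: 'b itself) A \<longleftrightarrow> in_GsA A \<and>
     (\<forall>B :: 'b tsalg. in_GsA B \<longrightarrow>
        (\<forall>S. star_subalgebra (sa_prod A B) S \<longrightarrow>
           snd ` cstar_closure (sa_prod A B) S = cstar_closure B (snd ` S)))"

text \<open>A_r is realised as the completion of A/ker r by classes of r-Cauchy sequences.\<close>

definition r_cauchy :: "'a tsalg \<Rightarrow> (nat \<Rightarrow> 'a) \<Rightarrow> bool" where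
  "r_cauchy A X \<longleftrightarrow> (\<forall>n. X n \<in> sa_carrier A) \<and>
     (\<forall>e>0. \<exists>N. \<forall>m\<ge>N. \<forall>n\<ge>N. largest_seminorm A (sa_diff A (X m) (X n)) < e)"

definition r_class :: "'a tsalg \<Rightarrow> (nat \<Rightarrow> 'a) \<Rightarrow> (nat \<Rightarrow> 'a) set" where
  "r_class A X = {Y. r_cauchy A Y \<and>
     (\<lambda>n. largest_seminorm A (sa_diff A (X n) (Y n))) \<longlonglongrightarrow> 0}"

definition envelope_carrier :: "'a tsalg \<Rightarrow> (nat \<Rightarrow> 'a) set set" where
  "envelope_carrier A = {r_class A X | X. r_cauchy A X}"

definition envelope_map :: "'a tsalg \<Rightarrow> 'a \<Rightarrow> (nat \<Rightarrow> 'a) set" where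
  "envelope_map A x = r_class A (\<lambda>n. x)"

end

theory Submission
  imports Defs "HOL-Computational_Algebra.Polynomial"
begin

text \<open>
  Let \<open>r\<close> and \<open>s\<close> be the largest seminorms of \<open>A\<close> and \<open>B\<close>. A seminorm on \<open>A \<times> B\<close> is at most
  \<open>r(a) + s(b)\<close>, so the representation topology of \<open>A \<times> B\<close> is given by \<open>r\<close> and \<open>s\<close>. Surjectivity of \<open>A \<rightarrow> C\<^sup>*(A)\<close> means that every \<open>r\<close>-Cauchy sequence converges in \<open>A\<close>.

  If \<open>A\<close> is complete, one must lift an approximation \<open>b\<^sub>n \<rightarrow> b\<close> in \<open>\<pi>\<^sub>B(S)\<close> to an \<open>r\<close>-Cauchy
  sequence in \<open>S\<close>. For this it suffices to replace \<open>t \<in> S\<close> with small \<open>s(t)\<close> by \<open>t' \<in> S\<close> with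
  \<open>r(t')\<close> of the same order as \<open>s(t)\<close> and \<open>s(t - t')\<close> as small as desired. Take \<open>t' = g(h)t\<close>, where
  \<open>h = tt\<^sup>*\<close> and \<open>g\<close> is a polynomial approximating \<open>1 / (1 + x\<^sup>2\<^sup>m)\<close>, namely a partial Neumann series.
  The norm bounds come from Arens' inequality \<open>\<parallel>x\<parallel>\<^sup>2 \<le> \<parallel>x\<^sup>2 + y\<^sup>2\<parallel>\<close> for commuting self-adjoint \<open>x, y\<close>, so no
  spectral theory is needed.

  Conversely, test compactness with the algebra \<open>B\<close> of \<open>r\<close>-Cauchy sequences under the limit seminorm
  and with the graph of the map sending \<open>a\<close> to its constant sequence: the image of the graph is dense in
  \<open>B\<close>, and a point \<open>(a, X)\<close> in the closure of the graph satisfies \<open>X\<^sub>n \<rightarrow> a\<close>.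
\<close>

section \<open>Seminorms on real polynomials\<close>

abbreviation pX :: "real poly" where "pX \<equiv> [:0, 1:]"

text \<open>Abstracts \<open>N P = p (P(h)h)\<close> for a self-adjoint \<open>h\<close>. Without a
  unit \<open>P(h)\<close> alone has no meaning, and the product of \<open>P(h)h\<close> and
  \<open>Q(h)h\<close> is \<open>(P Q X)(h)h\<close>; hence the factor \<open>pX\<close> in the last
  two axioms.\<close>

locale poly_cstar =
  fixes N :: "real poly \<Rightarrow> real"
  assumes nonneg: "0 \<le> N P"
    and smult: "N (smult c P) = \<bar>c\<bar> * N P"
    and triangle: "N (P + Q) \<le> N P + N Q"
    and submult: "N (P * Q * pX) \<le> N P * N Q"
    and arens: "(N P)\<^sup>2 \<le> N ((P\<^sup>2 + Q\<^sup>2) * pX)"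
begin

lemma zero: "N 0 = 0"
  using smult[of 0 0] by simp

lemma square_le: "N (P\<^sup>2 * pX) \<le> (N P)\<^sup>2"
  using submult[of P P] by (simp add: power2_eq_square)

lemma le_square: "(N P)\<^sup>2 \<le> N (P\<^sup>2 * pX)"
  using arens[of P 0] by simp

lemma sum_le: "N (\<Sum>j\<in>J. f j) \<le> (\<Sum>j\<in>J. N (f j))"
proof (induction J rule: infinite_finite_induct)
  case (insert x F)
  then show ?case using triangle[of "f x" "sum f F"] by simp
qed (auto simp: zero)

lemma power_bound:
  assumes "\<And>P. N (c * P) \<le> b * N P" "0 \<le> b"
  shows "N (c ^ j * P) \<le> b ^ j * N P"
proof (induction j)
  case (Suc j)
  have "N (c ^ Suc j * P) \<le> b * N (c ^ j * P)"
    using assms(1)[of "c ^ j * P"] by (simp add: mult.assoc)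
  also have "\<dots> \<le> b * (b ^ j * N P)"
    using Suc assms(2) by (intro mult_left_mono)
  finally show ?case by (simp add: mult.assoc)
qed simp

text \<open>In the sense of \<open>submult\<close>, \<open>X^(m+1) P\<close> is the product of
  \<open>X^m\<close> and \<open>P\<close>. The constant \<open>N (X^m)\<close> stands for the
  seminorm of \<open>h^(m+1)\<close>.\<close>

lemma X_power_mult_le: "N (pX ^ Suc m * P) \<le> N (pX ^ m) * N P"
  using submult[of "pX ^ m" P] by (simp only: power_Suc mult_ac)

lemma X_power_le: "N (pX ^ m) \<le> N 1 ^ Suc m"
proof -
  have "N (pX * P) \<le> N 1 * N P" for P
    using X_power_mult_le[of 0 P] by simp
  from power_bound[OF this nonneg, of m 1] show ?thesis by (simp add: mult.commute)
qed

text \<open>Arens' inequality with \<open>sqrt (2 L) k P\<close> as second element cancels the mixed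
  term: \<open>(L - k^2)^2 + 2 L k^2 = L^2 + k^4\<close>. The excess 1/2 over \<open>L\<close> still
  leaves a factor below 1 after division by \<open>L + 1\<close>.\<close>

lemma shifted_square_bound:
  assumes k: "\<And>P. N (k * P) \<le> \<kappa> * N P" and "0 \<le> \<kappa>" "\<kappa> ^ 4 \<le> L"
  shows "N (([:L:] - k\<^sup>2) * P) \<le> (L + 1/2) * N P"
proof -
  have L: "0 \<le> L" using assms(2,3) by (meson order_trans zero_le_power)
  have "(N (([:L:] - k\<^sup>2) * P))\<^sup>2
      \<le> N (((([:L:] - k\<^sup>2) * P)\<^sup>2 + ([:sqrt (2 * L):] * k * P)\<^sup>2) * pX)"
    by (rule arens)
  also have "((([:L:] - k\<^sup>2) * P)\<^sup>2 + ([:sqrt (2 * L):] * k * P)\<^sup>2) * pX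
      = smult (L\<^sup>2) (P\<^sup>2 * pX) + k ^ 4 * (P\<^sup>2 * pX)"
  proof -
    have 1: "[:sqrt (2 * L):] ^ 2 = 2 * [:L:]"
      using L by (simp add: power2_eq_square numeral_poly)
    have 2: "smult (L\<^sup>2) Q = [:L:]^2 * Q" for Q
      by (simp add: power2_eq_square)
    show ?thesis
      unfolding power_mult_distrib 1 2
      by (simp only: power4_eq_xxxx power2_eq_square) (simp only: algebra_simps)
  qed
  also have "N \<dots> \<le> L\<^sup>2 * N (P\<^sup>2 * pX) + N (k ^ 4 * (P\<^sup>2 * pX))"
    using triangle smult by (metis abs_power2)
  also have "\<dots> \<le> L\<^sup>2 * N (P\<^sup>2 * pX) + \<kappa> ^ 4 * N (P\<^sup>2 * pX)"
    by (intro add_left_mono power_bound[OF k \<open>0 \<le> \<kappa>\<close>])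
  also have "\<dots> = (L\<^sup>2 + \<kappa> ^ 4) * N (P\<^sup>2 * pX)"
    by (simp add: algebra_simps)
  \<comment> \<open>The assumption \<open>\<kappa> ^ 4 \<le> L\<close> enters here:
    \<open>L^2 + L \<le> (L + 1/2)^2\<close>.\<close>
  also have "\<dots> \<le> (L + 1/2)\<^sup>2 * (N P)\<^sup>2"
    using assms(3) L square_le nonneg
    by (intro mult_mono) (auto simp: power2_eq_square algebra_simps)
  finally have "(N (([:L:] - k\<^sup>2) * P))\<^sup>2 \<le> ((L + 1/2) * N P)\<^sup>2"
    by (simp add: power_mult_distrib)
  then show ?thesis
    by (rule power2_le_imp_le) (use L nonneg in auto)
qed

end

section \<open>Polynomial approximation of \<open>1 / (1 + k^2)\<close>\<close>

definition damp :: "real \<Rightarrow> real poly \<Rightarrow> real poly" where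
  "damp L k = smult (1 / (L + 1)) ([:L:] - k\<^sup>2)"

text \<open>Partial sum of the Neumann series of \<open>1 / (1 + k\<^sup>2)\<close> around \<open>L + 1\<close>.\<close>
definition resolvent :: "real \<Rightarrow> nat \<Rightarrow> real poly \<Rightarrow> real poly" where
  "resolvent L J k = smult (1 / (L + 1)) (\<Sum>j<J. damp L k ^ j)"

text \<open>\<open>damp L k\<close> equals \<open>1 - (1 + k^2) / (L + 1)\<close>, so the geometric
  sum telescopes and leaves a power of \<open>damp L k\<close> as exact remainder.\<close>

lemma resolvent_mult:
  assumes "0 \<le> L"
  shows "(1 + k\<^sup>2) * resolvent L J k = 1 - damp L k ^ J"
proof -
  have "1 + k\<^sup>2 = smult (L + 1) (1 - damp L k)"
    using assms by (simp add: damp_def smult_diff_right one_pCons)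
  then show ?thesis
    using assms by (simp add: resolvent_def one_diff_power_eq)
qed

context poly_cstar
begin

context
  fixes k :: "real poly" and \<kappa> L :: real
  assumes k: "\<And>P. N (k * P) \<le> \<kappa> * N P" and \<kappa>: "0 \<le> \<kappa>" "\<kappa> ^ 4 \<le> L"
begin

private lemma L: "0 \<le> L" using \<kappa> by (meson order_trans zero_le_power)

text \<open>Dividing the bound for \<open>L - k^2\<close> by \<open>L + 1\<close> gives a factor
  below 1, so the remainder of the Neumann series becomes arbitrarily small as \<open>j\<close>
  grows.\<close>

lemma damp_power_bound: "N (damp L k ^ j * P) \<le> ((L + 1/2) / (L + 1)) ^ j * N P"
proof (rule power_bound)
  show "N (damp L k * P) \<le> (L + 1/2) / (L + 1) * N P" for P
    using divide_right_mono[OF shifted_square_bound[OF k \<kappa>, of P], of "L + 1"] L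
    by (simp add: damp_def smult)
qed (use L in simp)

text \<open>The geometric series sums to at most \<open>2 (L + 1)\<close>, and the prefactor
  \<open>1 / (L + 1)\<close> cancels \<open>L\<close>. The bound is thus uniform, although
  \<open>L\<close> may be huge.\<close>

lemma resolvent_bound: "N (resolvent L J k * P) \<le> 2 * N P"
proof -
  define \<theta> where "\<theta> = (L + 1/2) / (L + 1)"
  have \<theta>: "0 \<le> \<theta>" "\<theta> < 1" "1 - \<theta> = 1 / (2 * (L + 1))"
    using L by (auto simp: \<theta>_def divide_simps)
  have "N (resolvent L J k * P) = N (\<Sum>j<J. damp L k ^ j * P) / (L + 1)"
    using L by (simp add: resolvent_def smult sum_distrib_right)
  also have "\<dots> \<le> (\<Sum>j<J. N (damp L k ^ j * P)) / (L + 1)"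
    using L by (intro divide_right_mono sum_le) simp
  also have "\<dots> \<le> (\<Sum>j<J. \<theta> ^ j * N P) / (L + 1)"
    using L damp_power_bound by (intro divide_right_mono sum_mono) (auto simp: \<theta>_def)
  also have "\<dots> = (\<Sum>j<J. \<theta> ^ j) * N P / (L + 1)"
    by (simp add: sum_distrib_right)
  also have "(\<Sum>j<J. \<theta> ^ j) = (1 - \<theta> ^ J) * (2 * (L + 1))"
    using \<theta> by (simp add: sum_gp_strict)
  also have "(1 - \<theta> ^ J) * (2 * (L + 1)) * N P / (L + 1) = (1 - \<theta> ^ J) * (2 * N P)"
    using L by (simp add: field_simps)
  also have "\<dots> \<le> 1 * (2 * N P)"
    using \<theta> nonneg by (intro mult_right_mono) auto
  finally show ?thesis by simp
qed

text \<open>With \<open>g\<close> the resolvent, \<open>1 - g\<close> is \<open>k^2 g\<close> plus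
  the Neumann remainder. So \<open>g\<close> is close to 1 when \<open>\<kappa>\<close> is small and
  \<open>J\<close> large.\<close>

lemma one_minus_resolvent_bound:
  "N ((1 - resolvent L J k) * P) \<le> (2 * \<kappa>\<^sup>2 + ((L + 1/2) / (L + 1)) ^ J) * N P"
proof -
  have "(1 - resolvent L J k) * P
      = k\<^sup>2 * (resolvent L J k * P) + damp L k ^ J * P"
  proof -
    have "1 - resolvent L J k = k\<^sup>2 * resolvent L J k + damp L k ^ J"
      using resolvent_mult[OF L, of k J] by (simp add: algebra_simps)
    then show ?thesis by (simp only: distrib_right mult.assoc)
  qed
  then have "N ((1 - resolvent L J k) * P)
      \<le> N (k\<^sup>2 * (resolvent L J k * P)) + N (damp L k ^ J * P)"
    by (metis triangle)
  also have "\<dots> \<le> \<kappa>\<^sup>2 * (2 * N P) + ((L + 1/2) / (L + 1)) ^ J * N P"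
    using power_bound[OF k \<kappa>(1), of 2] resolvent_bound damp_power_bound \<kappa>
    by (intro add_mono) (meson mult_left_mono order_trans zero_le_power)+
  finally show ?thesis by (simp add: algebra_simps)
qed

text \<open>The analogue of the boundedness of \<open>x / (1 + x^2)\<close>: the constant does not
  involve \<open>\<kappa>\<close>, so the bound is useful for large \<open>k\<close> as
  well.\<close>

lemma mult_resolvent_bound: "N (k * resolvent L J k * P) \<le> 2 * N P"
proof -
  let ?g = "resolvent L J k"
  \<comment> \<open>The second element is \<open>g P\<close>, because
    \<open>(k g)^2 + g^2 = (1 + k^2) g g\<close>, where \<open>resolvent_mult\<close> turns
    \<open>(1 + k^2) g\<close> into 1 minus the remainder.\<close>
  have "(N (k * ?g * P))\<^sup>2 \<le> N (((k * ?g * P)\<^sup>2 + (?g * P)\<^sup>2) * pX)"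
    by (rule arens)
  also have "((k * ?g * P)\<^sup>2 + (?g * P)\<^sup>2) * pX = ((1 + k\<^sup>2) * ?g) * (?g * (P\<^sup>2 * pX))"
    by (simp only: power2_eq_square algebra_simps mult_1_left mult_1_right)
  also have "\<dots> = ?g * (P\<^sup>2 * pX) + smult (-1) (damp L k ^ J * (?g * (P\<^sup>2 * pX)))"
    unfolding resolvent_mult[OF L] by (simp add: left_diff_distrib)
  also have "N \<dots> \<le> N (?g * (P\<^sup>2 * pX)) + N (damp L k ^ J * (?g * (P\<^sup>2 * pX)))"
    using triangle smult by (metis abs_minus_cancel abs_one mult_1)
  also have "\<dots> \<le> N (?g * (P\<^sup>2 * pX)) + 1 * N (?g * (P\<^sup>2 * pX))"
  proof -
    have "((L + 1/2) / (L + 1)) ^ J \<le> 1"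
      using L by (intro power_le_one) auto
    from mult_right_mono[OF this nonneg[of "?g * (P\<^sup>2 * pX)"]]
    show ?thesis
      using damp_power_bound[of J "?g * (P\<^sup>2 * pX)"] by linarith
  qed
  also have "\<dots> \<le> 4 * N (P\<^sup>2 * pX)"
    using resolvent_bound[of J "P\<^sup>2 * pX"] by simp
  also have "\<dots> \<le> (2 * N P)\<^sup>2"
    using square_le[of P] by (simp add: power_mult_distrib)
  finally show ?thesis
    by (rule power2_le_imp_le) (simp add: nonneg)
qed

end

text \<open>A bound for \<open>X ^ (2 * n)\<close> descends to \<open>X ^ n\<close> by the \<open>C\<^sup>*\<close>-identity.\<close>
lemma X_power_two_descent:
  assumes g: "\<And>P. N (g * P) \<le> 2 * N P"
    and "\<And>P. N (pX ^ (2 ^ i) * g * P) \<le> 2 * N P"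
  shows "N (pX * g * P) \<le> 2 * N P"
  using assms(2)
proof (induction i arbitrary: P)
  case (Suc i)
  have "N (pX ^ (2 ^ i) * g * P) \<le> 2 * N P" for P
  proof -
    have "(N (pX ^ (2 ^ i) * g * P))\<^sup>2 \<le> N ((pX ^ (2 ^ i) * g * P)\<^sup>2 * pX)"
      by (rule le_square)
    also have "(pX ^ (2 ^ i) * g * P)\<^sup>2 * pX = g * (pX ^ (2 ^ Suc i) * g * (P\<^sup>2 * pX))"
    proof -
      have "pX ^ (2 ^ Suc i) = (pX ^ (2 ^ i))\<^sup>2"
        by (simp add: power_mult[symmetric] mult.commute)
      then show ?thesis by (simp only: power2_eq_square mult_ac)
    qed
    \<comment> \<open>One factor 2 comes from \<open>g\<close>, the other from the bound for the
      doubled exponent. Since \<open>2 * 2 = 2^2\<close>, the square root returns the same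
      constant.\<close>
    also have "N \<dots> \<le> 2 * (2 * N (P\<^sup>2 * pX))"
      using g Suc.prems by (smt (verit, best))
    also have "\<dots> \<le> (2 * N P)\<^sup>2"
      using square_le[of P] by (simp add: power_mult_distrib)
    finally show ?thesis
      by (rule power2_le_imp_le) (simp add: nonneg)
  qed
  then show ?case by (rule Suc.IH)
qed simp

end

text \<open>The polynomial \<open>g\<close> approximates \<open>1 / (1 + X^(2^(i+1)))\<close>. For
  \<open>N1\<close>, where \<open>h\<close> may be large, \<open>x g(x)^2\<close> stays bounded; for
  \<open>N2\<close>, where \<open>h\<close> has norm at most 1/2, a high power is negligible and
  \<open>g\<close> is nearly 1. The two quantities bounded are the squared seminorms of
  \<open>g(h)t\<close> and \<open>t - g(h)t\<close>.\<close>

lemma poly_cstar_cutoff: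
  assumes "poly_cstar N1" "poly_cstar N2" and N2: "N2 1 \<le> 1/2" and "0 < \<epsilon>"
  shows "\<exists>g. N1 (g\<^sup>2) \<le> 4 \<and> N2 ((1 - g)\<^sup>2) < \<epsilon>"
proof -
  interpret N1: poly_cstar N1 by fact
  interpret N2: poly_cstar N2 by fact
  \<comment> \<open>The cap 1 makes \<open>\<kappa>2\<close> and \<open>\<delta>\<close> at most 1,
    so that their squares can be bounded linearly.\<close>
  define \<eta> where "\<eta> = min 1 \<epsilon>"
  have \<eta>: "0 < \<eta>" "\<eta> \<le> 1" "\<eta> \<le> \<epsilon>" using \<open>0 < \<epsilon>\<close> by (auto simp: \<eta>_def)
  obtain i :: nat where i: "(1/2) ^ i < \<eta> / 4"
    using real_arch_pow_inv[of "\<eta> / 4" "1/2"] \<eta> by auto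
  \<comment> \<open>The exponent \<open>Suc m\<close> is a power of two so that
    \<open>X_power_two_descent\<close> can bring the bound for \<open>k g\<close> down to one for
    \<open>X g\<close>.\<close>
  define m where "m = (2::nat) ^ i - 1"
  have m: "Suc m = 2 ^ i" by (simp add: m_def)
  define k where "k = pX ^ Suc m"
  define \<kappa>1 \<kappa>2 where "\<kappa>1 = N1 (pX ^ m)" and "\<kappa>2 = N2 (pX ^ m)"
  have k1: "\<And>P. N1 (k * P) \<le> \<kappa>1 * N1 P" and k2: "\<And>P. N2 (k * P) \<le> \<kappa>2 * N2 P"
    unfolding k_def \<kappa>1_def \<kappa>2_def by (rule N1.X_power_mult_le N2.X_power_mult_le)+
  have \<kappa>1: "0 \<le> \<kappa>1" and \<kappa>2: "0 \<le> \<kappa>2"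
    by (simp_all add: \<kappa>1_def \<kappa>2_def N1.nonneg N2.nonneg)
  \<comment> \<open>One \<open>L\<close> dominates both constants, since the same \<open>g\<close>
    must serve both seminorms.\<close>
  define L where "L = max (\<kappa>1 ^ 4) (\<kappa>2 ^ 4)"
  have L1: "\<kappa>1 ^ 4 \<le> L" and L2: "\<kappa>2 ^ 4 \<le> L" by (simp_all add: L_def)
  have L: "0 \<le> L" using L1 \<kappa>1 by (meson order_trans zero_le_power)
  define \<theta> where "\<theta> = (L + 1/2) / (L + 1)"
  have \<theta>: "0 \<le> \<theta>" "\<theta> < 1" using L by (auto simp: \<theta>_def divide_simps)
  obtain J where J: "\<theta> ^ J < \<eta> / 2"
    using real_arch_pow_inv[of "\<eta> / 2" \<theta>] \<theta> \<eta> by auto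
  define g where "g = resolvent L J k"
  have "N1 (pX * g * P) \<le> 2 * N1 P" for P
    using N1.resolvent_bound[OF k1 \<kappa>1 L1, of J] N1.mult_resolvent_bound[OF k1 \<kappa>1 L1, of J]
    unfolding g_def k_def m by (rule N1.X_power_two_descent)
  \<comment> \<open>Taking \<open>P = g\<close> bounds \<open>N1 (X g^2)\<close>; the C*-identity
    turns this into a quadratic inequality for \<open>N1 g\<close>.\<close>
  from this[of g] have "(N1 g)\<^sup>2 \<le> 2 * N1 g"
    using N1.le_square[of g] by (simp add: power2_eq_square mult_ac)
  then have "N1 g \<le> 2"
    using N1.nonneg[of g] by (cases "N1 g = 0") (auto simp: power2_eq_square)
  moreover have "N1 (g\<^sup>2) \<le> 2 * N1 g"
    using N1.resolvent_bound[OF k1 \<kappa>1 L1, of J g] by (simp add: g_def power2_eq_square)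
  ultimately have 1: "N1 (g\<^sup>2) \<le> 4" by simp
  define \<delta> where "\<delta> = 2 * \<kappa>2\<^sup>2 + \<theta> ^ J"
  \<comment> \<open>In the model this is a product of \<open>2^i\<close> factors \<open>h\<close>,
    each of norm at most 1/2.\<close>
  have "\<kappa>2 \<le> N2 1 ^ 2 ^ i"
    using N2.X_power_le[of m] unfolding m \<kappa>2_def .
  also have "\<dots> \<le> (1/2) ^ 2 ^ i"
    using N2 N2.nonneg by (intro power_mono) auto
  also have "\<dots> \<le> (1/2) ^ i"
    by (intro power_decreasing) (auto simp: less_imp_le)
  finally have "\<kappa>2 < \<eta> / 4" using i by simp
  then have "\<kappa>2\<^sup>2 \<le> \<eta> / 4 * 1"
    unfolding power2_eq_square using \<kappa>2 \<eta> by (intro mult_mono) auto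
  then have \<delta>: "0 \<le> \<delta>" "\<delta> < \<eta>"
    using J \<theta> unfolding \<delta>_def by auto
  have b: "N2 ((1 - g) * P) \<le> \<delta> * N2 P" for P
    using N2.one_minus_resolvent_bound[OF k2 \<kappa>2 L2, of J P] by (simp add: g_def \<delta>_def \<theta>_def)
  have "N2 ((1 - g)\<^sup>2) \<le> \<delta>\<^sup>2 * N2 1"
    using N2.power_bound[OF b \<delta>(1), of 2 1] by simp
  also have "\<dots> \<le> \<delta> * 1 * (1/2)"
    unfolding power2_eq_square using N2 N2.nonneg \<delta> \<eta> by (intro mult_mono) auto
  also have "\<dots> < \<epsilon>" using \<delta> \<eta> by simp
  finally show ?thesis using 1 by blast
qed

section \<open>Seminormed *-algebras\<close>

locale star_alg =
  fixes A :: "'a tsalg"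
  assumes star_algebra: "star_algebra A"
begin

abbreviation carr where "carr \<equiv> sa_carrier A"
abbreviation zero where "zero \<equiv> sa_zero A"
abbreviation star where "star \<equiv> sa_star A"
abbreviation add (infixl "\<boxplus>" 65) where "x \<boxplus> y \<equiv> sa_add A x y"
abbreviation diff (infixl "\<boxminus>" 65) where "x \<boxminus> y \<equiv> sa_diff A x y"
abbreviation mul (infixl "\<boxtimes>" 70) where "x \<boxtimes> y \<equiv> sa_mul A x y"
abbreviation scale (infixr "\<odot>" 75) where "c \<odot> x \<equiv> sa_smul A c x"

lemmas star_algebra_unfolded = star_algebra[unfolded star_algebra_def Let_def]

lemma closed [simp]:
  "zero \<in> carr"
  "x \<in> carr \<Longrightarrow> y \<in> carr \<Longrightarrow> x \<boxplus> y \<in> carr"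
  "x \<in> carr \<Longrightarrow> y \<in> carr \<Longrightarrow> x \<boxtimes> y \<in> carr"
  "x \<in> carr \<Longrightarrow> c \<odot> x \<in> carr"
  "x \<in> carr \<Longrightarrow> star x \<in> carr"
  using star_algebra_unfolded by simp_all

lemma
  assumes "x \<in> carr" "y \<in> carr" "w \<in> carr"
  shows add_assoc: "x \<boxplus> y \<boxplus> w = x \<boxplus> (y \<boxplus> w)"
    and mul_assoc: "x \<boxtimes> y \<boxtimes> w = x \<boxtimes> (y \<boxtimes> w)"
    and mul_add: "x \<boxtimes> (y \<boxplus> w) = x \<boxtimes> y \<boxplus> x \<boxtimes> w"
    and add_mul: "(x \<boxplus> y) \<boxtimes> w = x \<boxtimes> w \<boxplus> y \<boxtimes> w"
  using star_algebra_unfolded assms by metis+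

lemma
  assumes "x \<in> carr" "y \<in> carr"
  shows add_commute: "x \<boxplus> y = y \<boxplus> x"
    and scale_add_right: "c \<odot> (x \<boxplus> y) = c \<odot> x \<boxplus> c \<odot> y"
    and mul_scale: "x \<boxtimes> c \<odot> y = c \<odot> (x \<boxtimes> y)"
    and scale_mul: "(c \<odot> x) \<boxtimes> y = c \<odot> (x \<boxtimes> y)"
    and star_add: "star (x \<boxplus> y) = star x \<boxplus> star y"
    and star_mul: "star (x \<boxtimes> y) = star y \<boxtimes> star x"
  using star_algebra_unfolded assms by metis+

lemma
  assumes "x \<in> carr"
  shows zero_add [simp]: "zero \<boxplus> x = x"
    and add_neg: "x \<boxplus> (-1) \<odot> x = zero"
    and scale_add_left: "(c + d) \<odot> x = c \<odot> x \<boxplus> d \<odot> x"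
    and scale_scale [simp]: "c \<odot> d \<odot> x = (c * d) \<odot> x"
    and scale_one [simp]: "1 \<odot> x = x"
    and star_scale: "star (c \<odot> x) = cnj c \<odot> star x"
    and star_star [simp]: "star (star x) = x"
  using star_algebra_unfolded assms by metis+

lemma add_left_commute:
  "x \<in> carr \<Longrightarrow> y \<in> carr \<Longrightarrow> w \<in> carr \<Longrightarrow> x \<boxplus> (y \<boxplus> w) = y \<boxplus> (x \<boxplus> w)"
  by (metis add_assoc add_commute)

lemmas add_ac = add_assoc add_commute add_left_commute

lemma add_zero [simp]: "x \<in> carr \<Longrightarrow> x \<boxplus> zero = x"
  by (metis add_commute closed(1) zero_add)

lemma scale_zero_left [simp]: "x \<in> carr \<Longrightarrow> 0 \<odot> x = zero"
  using scale_add_left[of x 1 "-1"] by (simp add: add_neg)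

lemma scale_zero [simp]: "c \<odot> zero = zero"
  using scale_scale[of zero c 0] by simp

lemma mul_zero [simp]: "x \<in> carr \<Longrightarrow> x \<boxtimes> zero = zero"
  using mul_scale[of x zero 0] by simp

lemma zero_mul [simp]: "x \<in> carr \<Longrightarrow> zero \<boxtimes> x = zero"
  using scale_mul[of zero x 0] by simp

lemma star_zero [simp]: "star zero = zero"
  using star_scale[of zero 0] by simp

lemma diff_eq: "x \<boxminus> y = x \<boxplus> (-1) \<odot> y"
  by (simp add: sa_diff_def sa_neg_def)

lemma diff_closed [simp]: "x \<in> carr \<Longrightarrow> y \<in> carr \<Longrightarrow> x \<boxminus> y \<in> carr"
  by (simp add: diff_eq)

lemma diff_self [simp]: "x \<in> carr \<Longrightarrow> x \<boxminus> x = zero"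
  by (simp add: diff_eq add_neg)

lemma diff_zero [simp]: "x \<in> carr \<Longrightarrow> x \<boxminus> zero = x"
  by (simp add: diff_eq)

lemma add_neg_cancel: "x \<in> carr \<Longrightarrow> y \<in> carr \<Longrightarrow> (-1) \<odot> x \<boxplus> (x \<boxplus> y) = y"
  by (metis add_assoc add_commute add_neg closed(4) zero_add)

lemma diff_add_diff:
  "x \<in> carr \<Longrightarrow> y \<in> carr \<Longrightarrow> w \<in> carr \<Longrightarrow> (x \<boxminus> y) \<boxplus> (y \<boxminus> w) = x \<boxminus> w"
  by (simp add: diff_eq add_assoc add_neg_cancel)

lemma diff_swap: "x \<in> carr \<Longrightarrow> y \<in> carr \<Longrightarrow> x \<boxminus> y = (-1) \<odot> (y \<boxminus> x)"
  by (simp add: diff_eq scale_add_right add_commute)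

lemma scale_diff: "x \<in> carr \<Longrightarrow> y \<in> carr \<Longrightarrow> c \<odot> (x \<boxminus> y) = c \<odot> x \<boxminus> c \<odot> y"
  by (simp add: diff_eq scale_add_right mult.commute)

lemma star_diff: "x \<in> carr \<Longrightarrow> y \<in> carr \<Longrightarrow> star (x \<boxminus> y) = star x \<boxminus> star y"
  by (simp add: diff_eq star_add star_scale)

lemma mul_diff: "x \<in> carr \<Longrightarrow> y \<in> carr \<Longrightarrow> w \<in> carr \<Longrightarrow> x \<boxtimes> (y \<boxminus> w) = x \<boxtimes> y \<boxminus> x \<boxtimes> w"
  by (simp add: diff_eq mul_add mul_scale)

lemma diff_mul: "x \<in> carr \<Longrightarrow> y \<in> carr \<Longrightarrow> w \<in> carr \<Longrightarrow> (x \<boxminus> y) \<boxtimes> w = x \<boxtimes> w \<boxminus> y \<boxtimes> w"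
  by (simp add: diff_eq add_mul scale_mul)

lemma add_diff_add:
  "x \<in> carr \<Longrightarrow> y \<in> carr \<Longrightarrow> x' \<in> carr \<Longrightarrow> y' \<in> carr
    \<Longrightarrow> (x \<boxplus> y) \<boxminus> (x' \<boxplus> y') = (x \<boxminus> x') \<boxplus> (y \<boxminus> y')"
  by (simp add: diff_eq scale_add_right add_ac)

lemma mul_diff_mul:
  "x \<in> carr \<Longrightarrow> y \<in> carr \<Longrightarrow> x' \<in> carr \<Longrightarrow> y' \<in> carr
    \<Longrightarrow> x \<boxtimes> y \<boxminus> x' \<boxtimes> y' = (x \<boxminus> x') \<boxtimes> y \<boxplus> x' \<boxtimes> (y \<boxminus> y')"
  by (simp add: mul_diff diff_mul diff_add_diff)

text \<open>\<open>P(h)x\<close>, which makes sense without a unit even if \<open>P\<close> has a constant term.\<close>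
definition poly_act :: "'a \<Rightarrow> 'a \<Rightarrow> real poly \<Rightarrow> 'a" where
  "poly_act h x P = fold_coeffs (\<lambda>a y. complex_of_real a \<odot> x \<boxplus> h \<boxtimes> y) P zero"

lemma poly_act_0 [simp]: "poly_act h x 0 = zero"
  by (simp add: poly_act_def)

context
  fixes h assumes h [simp]: "h \<in> carr"
begin

lemma poly_act_pCons:
  "x \<in> carr \<Longrightarrow> poly_act h x (pCons a P) = complex_of_real a \<odot> x \<boxplus> h \<boxtimes> poly_act h x P"
  by (cases "a = 0"; cases "P = 0") (simp_all add: poly_act_def)

lemma poly_act_closed [simp]: "x \<in> carr \<Longrightarrow> poly_act h x P \<in> carr"
  by (induction P) (simp_all add: poly_act_pCons)

lemma poly_act_mem:
  assumes S: "star_subalgebra A S" and "h \<in> S" "x \<in> S"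
  shows "poly_act h x P \<in> S"
proof -
  have "x \<in> carr" using S \<open>x \<in> S\<close> by (auto simp: star_subalgebra_def)
  then show ?thesis
    using assms by (induction P) (auto simp: poly_act_pCons star_subalgebra_def)
qed

lemma poly_act_smult:
  "x \<in> carr \<Longrightarrow> poly_act h x (smult c P) = complex_of_real c \<odot> poly_act h x P"
  by (induction P) (simp_all add: poly_act_pCons scale_add_right mul_scale)

lemma poly_act_add:
  assumes x: "x \<in> carr"
  shows "poly_act h x (P + Q) = poly_act h x P \<boxplus> poly_act h x Q"
proof (induction P Q rule: poly_induct2)
  case (pCons a P b Q)
  then show ?case
    using x by (simp add: poly_act_pCons scale_add_left mul_add add_ac)
qed (use x in simp)

lemma poly_act_diff:
  "x \<in> carr \<Longrightarrow> poly_act h x (P - Q) = poly_act h x P \<boxminus> poly_act h x Q"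
  using poly_act_add[of x P "smult (-1) Q"] by (simp only: poly_act_smult diff_eq) simp

lemma poly_act_1: "x \<in> carr \<Longrightarrow> poly_act h x 1 = x"
  by (simp add: one_pCons poly_act_pCons)

lemma poly_act_mult:
  assumes x: "x \<in> carr"
  shows "poly_act h x (P * Q) = poly_act h (poly_act h x Q) P"
proof (induction P)
  case (pCons a P)
  then show ?case
    using x by (simp add: poly_act_pCons poly_act_add poly_act_smult)
qed simp

lemma poly_act_mul_right:
  assumes x: "x \<in> carr" and y: "y \<in> carr"
  shows "poly_act h x P \<boxtimes> y = poly_act h (x \<boxtimes> y) P"
  by (induction P) (simp_all add: x y poly_act_pCons add_mul scale_mul mul_assoc)

lemma poly_act_commute: "h \<boxtimes> poly_act h h P = poly_act h h P \<boxtimes> h"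
proof (induction P)
  case (pCons a P)
  then show ?case
    using mul_assoc[of h "poly_act h h P" h] mul_assoc[of "poly_act h h P" h h]
    by (simp add: poly_act_pCons add_mul mul_add scale_mul mul_scale)
qed simp

text \<open>Of the two trailing factors \<open>h\<close> one is absorbed into the polynomial; this
  is the origin of \<open>pX\<close> in \<open>poly_cstar\<close>.\<close>

lemma poly_act_mult_self:
  "poly_act h h P \<boxtimes> poly_act h h Q = poly_act h h (P * Q * pX)"
proof -
  have "poly_act h h (P * (pX * Q)) = poly_act h (poly_act h h (pX * Q)) P"
    by (simp only: poly_act_mult h)
  also have "poly_act h h (pX * Q) = h \<boxtimes> poly_act h h Q"
    by (simp add: poly_act_pCons)
  also have "poly_act h (h \<boxtimes> poly_act h h Q) P = poly_act h h P \<boxtimes> poly_act h h Q"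
    by (simp add: poly_act_mul_right)
  finally show ?thesis by (simp only: mult_ac)
qed

lemma star_poly_act: "star h = h \<Longrightarrow> star (poly_act h h P) = poly_act h h P"
  by (induction P)
    (simp_all add: poly_act_pCons star_add star_scale star_mul poly_act_commute)

end

end

section \<open>C*-seminorms and Arens' inequality\<close>

locale seminormed_star_alg = star_alg +
  fixes p :: "'a \<Rightarrow> real"
  assumes seminorm: "cstar_seminorm A p"
begin

lemmas seminorm_unfolded = seminorm[unfolded cstar_seminorm_def]

lemma
  assumes "x \<in> carr"
  shows p_nonneg [simp]: "0 \<le> p x"
    and p_scale: "p (c \<odot> x) = cmod c * p x"
    and p_star_mul: "p (star x \<boxtimes> x) = (p x)\<^sup>2"
  using seminorm_unfolded assms by simp_all

lemma
  assumes "x \<in> carr" "y \<in> carr"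
  shows p_add: "p (x \<boxplus> y) \<le> p x + p y"
    and p_mul: "p (x \<boxtimes> y) \<le> p x * p y"
  using seminorm_unfolded assms by simp_all

lemma p_zero [simp]: "p zero = 0"
  using p_scale[of zero 0] by simp

lemma p_diff_commute: "x \<in> carr \<Longrightarrow> y \<in> carr \<Longrightarrow> p (x \<boxminus> y) = p (y \<boxminus> x)"
  by (simp add: diff_swap[of x y] p_scale)

lemma p_diff_triangle:
  "x \<in> carr \<Longrightarrow> y \<in> carr \<Longrightarrow> w \<in> carr \<Longrightarrow> p (x \<boxminus> w) \<le> p (x \<boxminus> y) + p (y \<boxminus> w)"
  by (metis p_add diff_closed diff_add_diff)

lemma p_le_add_diff: "x \<in> carr \<Longrightarrow> y \<in> carr \<Longrightarrow> p x \<le> p y + p (x \<boxminus> y)"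
  using p_diff_triangle[of x y zero] by simp

lemma abs_p_diff_le: "x \<in> carr \<Longrightarrow> y \<in> carr \<Longrightarrow> \<bar>p x - p y\<bar> \<le> p (x \<boxminus> y)"
  using p_le_add_diff[of x y] p_le_add_diff[of y x] p_diff_commute[of x y] by linarith

text \<open>The C*-identity and submultiplicativity give \<open>p(x)^2 \<le> p(star x) p(x)\<close>;
  divide by \<open>p x\<close>.\<close>

lemma p_le_p_star: "x \<in> carr \<Longrightarrow> p x \<le> p (star x)"
  using p_star_mul[of x] p_mul[of "star x" x] mult_right_le_imp_le[of "p x" "p x" "p (star x)"]
  by (cases "p x = 0") (auto simp: power2_eq_square less_le)

lemma p_star [simp]: "x \<in> carr \<Longrightarrow> p (star x) = p x"
  using p_le_p_star[of x] p_le_p_star[of "star x"] by simp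

lemma p_mul_star: "x \<in> carr \<Longrightarrow> p (x \<boxtimes> star x) = (p x)\<^sup>2"
  using p_star_mul[of "star x"] by simp

text \<open>Arens' trick: \<open>x\<close> is the mean of \<open>x + iy\<close> and its adjoint, both of norm
  \<open>\<parallel>x\<^sup>2 + y\<^sup>2\<parallel>\<^sup>1\<^sup>/\<^sup>2\<close>. This replaces all positivity arguments for C*-algebras.\<close>
lemma arens_le:
  assumes x: "x \<in> carr" "star x = x" and y: "y \<in> carr" "star y = y"
    and xy: "x \<boxtimes> y = y \<boxtimes> x"
  shows "(p x)\<^sup>2 \<le> p (x \<boxtimes> x \<boxplus> y \<boxtimes> y)"
proof -
  define w where "w = x \<boxplus> \<i> \<odot> y"
  have w: "w \<in> carr" and sw: "star w = x \<boxplus> (-\<i>) \<odot> y"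
    using x y by (auto simp: w_def star_add star_scale)
  have "star w \<boxplus> w = x \<boxplus> x \<boxplus> ((-\<i>) \<odot> y \<boxplus> \<i> \<odot> y)"
    unfolding sw unfolding w_def using x y by (simp add: add_ac)
  also have "\<dots> = (2::complex) \<odot> x"
    using x y scale_add_left[of x 1 1] by (simp add: scale_add_left[symmetric])
  finally have "2 * p x = p (star w \<boxplus> w)"
    using x by (simp add: p_scale)
  also have "\<dots> \<le> 2 * p w"
    using p_add[of "star w" w] w by simp
  finally have "(p x)\<^sup>2 \<le> (p w)\<^sup>2"
    using x by (intro power_mono) auto
  also have "\<dots> = p (star w \<boxtimes> w)"
    using w by (simp add: p_star_mul)
  also have "star w \<boxtimes> w = x \<boxtimes> x \<boxplus> y \<boxtimes> y \<boxplus> (\<i> \<odot> (x \<boxtimes> y) \<boxplus> (-\<i>) \<odot> (x \<boxtimes> y))"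
    unfolding sw unfolding w_def using x y
    by (simp add: mul_add add_mul mul_scale scale_mul xy scale_add_right add_ac)
  also have "\<dots> = x \<boxtimes> x \<boxplus> y \<boxtimes> y"
    using x y by (simp add: scale_add_left[symmetric])
  finally show ?thesis .
qed

text \<open>The elements \<open>P(h)h\<close> are self-adjoint, as \<open>P\<close> has real
  coefficients, and they commute with each other, so \<open>arens_le\<close> applies to
  them.\<close>

lemma poly_cstar_poly_act:
  assumes h: "h \<in> carr" "star h = h"
  shows "poly_cstar (\<lambda>P. p (poly_act h h P))"
proof
  fix P Q :: "real poly" and c :: real
  show "0 \<le> p (poly_act h h P)" using h by simp
  show "p (poly_act h h (smult c P)) = \<bar>c\<bar> * p (poly_act h h P)"
    using h by (simp add: poly_act_smult p_scale)
  show "p (poly_act h h (P + Q)) \<le> p (poly_act h h P) + p (poly_act h h Q)"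
    using h by (simp add: poly_act_add p_add)
  show "p (poly_act h h (P * Q * pX)) \<le> p (poly_act h h P) * p (poly_act h h Q)"
    unfolding poly_act_mult_self[OF h(1), symmetric] using h by (simp add: p_mul)
  have "(P\<^sup>2 + Q\<^sup>2) * pX = P * P * pX + Q * Q * pX"
    by (simp only: power2_eq_square distrib_right)
  then have "poly_act h h ((P\<^sup>2 + Q\<^sup>2) * pX)
      = poly_act h h P \<boxtimes> poly_act h h P \<boxplus> poly_act h h Q \<boxtimes> poly_act h h Q"
    using h by (simp only: poly_act_add poly_act_mult_self)
  moreover have "poly_act h h P \<boxtimes> poly_act h h Q = poly_act h h Q \<boxtimes> poly_act h h P"
    using h by (simp only: poly_act_mult_self mult_ac)
  ultimately show "(p (poly_act h h P))\<^sup>2 \<le> p (poly_act h h ((P\<^sup>2 + Q\<^sup>2) * pX))"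
    using h by (simp only:) (intro arens_le, simp_all add: star_poly_act)
qed

text \<open>For \<open>y = P(h)t\<close>, the product of \<open>y\<close> and \<open>star y\<close>
  is \<open>P(h) h P(h) = P^2(h)h\<close>. This carries polynomial estimates over to elements
  \<open>P(h)t\<close> with \<open>t\<close> not self-adjoint.\<close>

lemma p_poly_act_square:
  assumes t: "t \<in> carr" and h_def: "h = t \<boxtimes> star t"
  shows "(p (poly_act h t P))\<^sup>2 = p (poly_act h h (P\<^sup>2))"
proof -
  have h [simp]: "h \<in> carr" and sh: "star h = h"
    using t by (simp_all add: h_def star_mul)
  have "t \<boxtimes> star (poly_act h t P) = star (poly_act h t P \<boxtimes> star t)"
    using t by (simp add: star_mul)
  also have "\<dots> = poly_act h h P"
    using t sh by (simp add: poly_act_mul_right h_def[symmetric] star_poly_act)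
  finally have "poly_act h t P \<boxtimes> star (poly_act h t P) = poly_act h (poly_act h h P) P"
    using t by (simp add: poly_act_mul_right)
  moreover have "(p (poly_act h t P))\<^sup>2 = p (poly_act h t P \<boxtimes> star (poly_act h t P))"
    using t by (simp add: p_mul_star)
  ultimately show ?thesis
    by (simp add: poly_act_mult power2_eq_square)
qed

end

section \<open>Lifting approximations along two seminorms\<close>

locale two_seminorms =
  p: seminormed_star_alg A p + q: seminormed_star_alg A q for A :: "'a tsalg" and p q
begin

lemma cutoff:
  assumes S: "star_subalgebra A S" and t: "t \<in> S" and qt: "(q t)\<^sup>2 \<le> 1/2" and "0 < e"
  obtains t' where "t' \<in> S" "p t' \<le> 2" "q (sa_diff A t t') < e"
proof -
  have tA [simp]: "t \<in> sa_carrier A" using S t by (auto simp: star_subalgebra_def)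
  define h where "h = sa_mul A t (sa_star A t)"
  have hS: "h \<in> S" using S t by (auto simp: star_subalgebra_def h_def)
  have h [simp]: "h \<in> sa_carrier A" and sh: "sa_star A h = h"
    by (simp_all add: h_def p.star_mul)
  \<comment> \<open>The polynomial 1 yields \<open>h\<close> itself, and
    \<open>q h = (q t)^2\<close>; this is the smallness that \<open>poly_cstar_cutoff\<close>
    requires of its second seminorm.\<close>
  have "q (p.poly_act h h 1) \<le> 1/2"
    using qt by (simp add: p.poly_act_1) (simp add: h_def q.p_mul_star)
  from poly_cstar_cutoff[OF p.poly_cstar_poly_act[OF h sh] q.poly_cstar_poly_act[OF h sh] this,
      of "e\<^sup>2"] \<open>0 < e\<close>
  obtain g where g: "p (p.poly_act h h (g\<^sup>2)) \<le> 4" "q (p.poly_act h h ((1 - g)\<^sup>2)) < e\<^sup>2"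
    by auto
  show thesis
  proof
    show "p.poly_act h t g \<in> S"
      using h S hS t by (rule p.poly_act_mem)
    have "(p (p.poly_act h t g))\<^sup>2 \<le> 2\<^sup>2"
      using g(1) by (simp add: p.p_poly_act_square[OF tA h_def])
    then show "p (p.poly_act h t g) \<le> 2"
      by (rule power2_le_imp_le) simp
    have "(q (sa_diff A t (p.poly_act h t g)))\<^sup>2 < e\<^sup>2"
      using g(2) q.p_poly_act_square[OF tA h_def, of "1 - g"]
      by (simp add: p.poly_act_diff p.poly_act_1)
    then show "q (sa_diff A t (p.poly_act h t g)) < e"
      by (rule power_less_imp_less_base) (use \<open>0 < e\<close> in simp)
  qed
qed

lemma cutoff_scaled:
  assumes S: "star_subalgebra A S" and t: "t \<in> S" and qt: "q t \<le> \<delta>" and "0 < e" "0 < \<delta>"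
  obtains t' where "t' \<in> S" "p t' \<le> 4 * \<delta>" "q (sa_diff A t t') < e"
proof -
  have tA [simp]: "t \<in> sa_carrier A" using S t by (auto simp: star_subalgebra_def)
  have S_smul: "sa_smul A c x \<in> S" and SA: "x \<in> sa_carrier A" if "x \<in> S" for c x
    using S that by (auto simp: star_subalgebra_def)
  \<comment> \<open>Rescaling brings \<open>t\<close> into the range of \<open>cutoff\<close>;
    scaling back turns its bound 2 into \<open>4 * \<delta>\<close>. A positive
    \<open>\<delta>\<close> is used in place of \<open>q t\<close>, which may vanish.\<close>
  have "q (sa_smul A (1 / (2 * \<delta>)) t) \<le> 1 / 2"
    using qt \<open>0 < \<delta>\<close> by (simp add: q.p_scale norm_divide norm_mult)
  then have "(q (sa_smul A (1 / (2 * \<delta>)) t))\<^sup>2 \<le> (1 / 2)\<^sup>2"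
    by (intro power_mono) auto
  then have "(q (sa_smul A (1 / (2 * \<delta>)) t))\<^sup>2 \<le> 1 / 2"
    by (simp add: power2_eq_square)
  then obtain u where u: "u \<in> S" "p u \<le> 2" "q (sa_diff A (sa_smul A (1 / (2 * \<delta>)) t) u) < e / (2 * \<delta>)"
    using cutoff[OF S S_smul[OF t], of "1 / (2 * \<delta>)" "e / (2 * \<delta>)"] \<open>0 < e\<close> \<open>0 < \<delta>\<close> by auto
  note [simp] = SA[OF u(1)]
  show thesis
  proof
    show "sa_smul A (2 * \<delta>) u \<in> S" using u S_smul by blast
    show "p (sa_smul A (2 * \<delta>) u) \<le> 4 * \<delta>"
      using u \<open>0 < \<delta>\<close> by (simp add: p.p_scale norm_mult)
    have "sa_diff A t (sa_smul A (2 * \<delta>) u)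
        = sa_smul A (2 * \<delta>) (sa_diff A (sa_smul A (1 / (2 * \<delta>)) t) u)"
      using \<open>0 < \<delta>\<close> by (simp add: p.scale_diff)
    then show "q (sa_diff A t (sa_smul A (2 * \<delta>) u)) < e"
      using u \<open>0 < \<delta>\<close> by (simp add: q.p_scale norm_mult field_simps)
  qed
qed

text \<open>Let \<open>t\<close> in \<open>S\<close> approximate \<open>b\<close> better than
  \<open>u = U n\<close> does. The step \<open>t - u\<close> is small for \<open>q\<close> but
  perhaps large for \<open>p\<close>; \<open>cutoff_scaled\<close> replaces it by \<open>d\<close>
  with \<open>p d\<close> controlled, and \<open>U (Suc n)\<close> is \<open>d + u\<close>.\<close>

lemma approximating_sequence:
  assumes S: "star_subalgebra A S" and b [simp]: "b \<in> sa_carrier A"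
    and close: "\<And>e. 0 < e \<Longrightarrow> \<exists>u\<in>S. q (sa_diff A u b) < e"
  obtains U where "\<And>n. U n \<in> S" "\<And>n. q (sa_diff A (U n) b) < (1/2) ^ n"
    "\<And>n. p (sa_diff A (U (Suc n)) (U n)) \<le> 8 * (1/2) ^ n"
proof -
  have SA [simp]: "x \<in> sa_carrier A" if "x \<in> S" for x
    using S that by (auto simp: star_subalgebra_def)
  have S_add: "sa_add A x y \<in> S" and S_diff: "sa_diff A x y \<in> S" if "x \<in> S" "y \<in> S" for x y
    using S that by (auto simp: star_subalgebra_def p.diff_eq)
  have "\<exists>U. \<forall>n. (U n \<in> S \<and> q (sa_diff A (U n) b) < (1/2) ^ n) \<and>
      p (sa_diff A (U (Suc n)) (U n)) \<le> 8 * (1/2) ^ n"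
  proof (rule dependent_nat_choice)
    show "\<exists>u. u \<in> S \<and> q (sa_diff A u b) < (1/2) ^ 0"
      using close[of 1] by auto
  next
    fix u and n :: nat
    assume u: "u \<in> S \<and> q (sa_diff A u b) < (1/2) ^ n"
    \<comment> \<open>Two errors below \<open>e\<close>, from \<open>t\<close> and from the cutoff,
      add up to less than \<open>(1/2) ^ Suc n\<close>.\<close>
    define e where "e = (1/2 :: real) ^ n / 4"
    have e: "0 < e" "(1/2 :: real) ^ n = 4 * e" by (simp_all add: e_def)
    obtain t where t: "t \<in> S" "q (sa_diff A t b) < e" using close[OF e(1)] by blast
    have "q (sa_diff A t u) \<le> q (sa_diff A t b) + q (sa_diff A b u)"
      using t u by (intro q.p_diff_triangle) auto
    also have "\<dots> \<le> 2 * (1/2) ^ n"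
      using t u e q.p_diff_commute[of u b] by simp
    finally obtain d where d: "d \<in> S" "p d \<le> 4 * (2 * (1/2) ^ n)"
        "q (sa_diff A (sa_diff A t u) d) < e"
      using cutoff_scaled[OF S S_diff, of t u "2 * (1/2) ^ n" e] t u e by auto
    have 1: "sa_diff A (sa_add A d u) u = d"
      using d u by (simp add: p.diff_eq p.add_assoc p.add_neg)
    have "sa_diff A (sa_add A d u) t = sa_diff A d (sa_diff A t u)"
      using d u t by (simp add: p.diff_eq p.add_assoc p.add_commute p.scale_add_right)
    then have "q (sa_diff A (sa_add A d u) t) < e"
      using d u t q.p_diff_commute[of d "sa_diff A t u"] by simp
    moreover have "q (sa_diff A (sa_add A d u) b)
        \<le> q (sa_diff A (sa_add A d u) t) + q (sa_diff A t b)"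
      using t u d by (intro q.p_diff_triangle) auto
    ultimately have "q (sa_diff A (sa_add A d u) b) < (1/2) ^ Suc n"
      using t e by simp
    then show "\<exists>v. (v \<in> S \<and> q (sa_diff A v b) < (1/2) ^ Suc n) \<and>
        p (sa_diff A v u) \<le> 8 * (1/2) ^ n"
      using 1 d u S_add by (intro exI[of _ "sa_add A d u"]) auto
  qed
  then show thesis using that by blast
qed

end

section \<open>The representation topology and products\<close>

context star_alg
begin

lemma cstar_seminorm_cong:
  assumes "\<And>x. x \<in> carr \<Longrightarrow> p x = q x"
  shows "cstar_seminorm A p \<longleftrightarrow> cstar_seminorm A q"
  using assms by (simp add: cstar_seminorm_def)

text \<open>A seminorm dominating all others up to a factor \<open>K\<close> generates the topology
  alone: a subbasic \<open>q\<close>-ball of radius \<open>e\<close> about \<open>x0\<close>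
  contains the \<open>p\<close>-ball of radius \<open>(e - q (x \<boxminus> x0)) / K\<close> about
  each of its points \<open>x\<close>. The factor is 1 for a largest seminorm and 2 for the norm
  used on products.\<close>

lemma cstar_closure_iff:
  assumes p: "p \<in> cont_cstar_seminorms A" and K: "0 < K"
    and dom: "\<And>q x. q \<in> cont_cstar_seminorms A \<Longrightarrow> x \<in> carr \<Longrightarrow> q x \<le> K * p x"
    and S: "S \<subseteq> carr"
  shows "x \<in> cstar_closure A S \<longleftrightarrow> x \<in> carr \<and> (\<forall>e>0. \<exists>y\<in>S. p (y \<boxminus> x) < e)"
proof -
  define \<B> where "\<B> = {{y \<in> carr. q (y \<boxminus> x) < e} | q x e.
        q \<in> cont_cstar_seminorms A \<and> x \<in> carr \<and> e > 0}"
  have ball: "{y \<in> carr. q (y \<boxminus> x) < e} \<in> \<B>"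
    if "q \<in> cont_cstar_seminorms A" "x \<in> carr" "e > 0" for q x e
    using that unfolding \<B>_def by blast
  have sem: "seminormed_star_alg A q" if "q \<in> cont_cstar_seminorms A" for q
    using that star_algebra
    by (simp add: seminormed_star_alg_def star_alg_def seminormed_star_alg_axioms_def
        cont_cstar_seminorms_def)
  have zero_self: "q (x \<boxminus> x) = 0" if "q \<in> cont_cstar_seminorms A" "x \<in> carr" for q x
    using seminormed_star_alg.p_zero[OF sem[OF that(1)]] that by simp
  have nbhd: "x \<in> U \<Longrightarrow> \<exists>e>0. \<forall>y\<in>carr. p (y \<boxminus> x) < e \<longrightarrow> y \<in> U"
    if "generate_topology_on \<B> U" for U x
    using that
  proof (induction U arbitrary: x)
    case (Int U V)
    then obtain d e where "d > 0" "\<forall>y\<in>carr. p (y \<boxminus> x) < d \<longrightarrow> y \<in> U"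
      "e > 0" "\<forall>y\<in>carr. p (y \<boxminus> x) < e \<longrightarrow> y \<in> V" by blast
    then show ?case by (intro exI[of _ "min d e"]) auto
  next
    case (UN \<U>)
    from UN.prems obtain V where V: "V \<in> \<U>" "x \<in> V" by blast
    from UN.IH[OF this] V(1) show ?case by blast
  next
    case (Basis U)
    then obtain q x0 e where q: "q \<in> cont_cstar_seminorms A" and x0: "x0 \<in> carr"
      and U: "U = {y \<in> carr. q (y \<boxminus> x0) < e}" unfolding \<B>_def by blast
    interpret q: seminormed_star_alg A q by (rule sem) fact
    have x: "x \<in> carr" "q (x \<boxminus> x0) < e" using Basis.prems U by auto
    have "y \<in> U" if y: "y \<in> carr" "p (y \<boxminus> x) < (e - q (x \<boxminus> x0)) / K" for y
    proof -
      have "q (y \<boxminus> x0) \<le> q (y \<boxminus> x) + q (x \<boxminus> x0)"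
        using x x0 y by (intro q.p_diff_triangle)
      also have "\<dots> \<le> K * p (y \<boxminus> x) + q (x \<boxminus> x0)"
        using dom[OF q] x y by simp
      also have "\<dots> < e" using y K by (simp add: field_simps)
      finally show ?thesis using U y by simp
    qed
    then show ?case using x K by (intro exI[of _ "(e - q (x \<boxminus> x0)) / K"]) auto
  qed simp
  have top: "rep_topology A = topology_generated_by \<B>"
    by (simp add: rep_topology_def \<B>_def)
  have carr: "\<Union>\<B> = carr"
  proof
    show "\<Union>\<B> \<subseteq> carr" by (auto simp: \<B>_def)
    show "carr \<subseteq> \<Union>\<B>"
    proof
      fix x assume "x \<in> carr"
      then show "x \<in> \<Union>\<B>"
        using zero_self[OF p] by (intro UnionI[OF ball[OF p _ zero_less_one]]) auto
    qed
  qed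
  show ?thesis
  proof
    assume x: "x \<in> cstar_closure A S"
    then have xA: "x \<in> carr" by (simp add: cstar_closure_def top in_closure_of carr)
    have "\<exists>y\<in>S. p (y \<boxminus> x) < e" if "e > 0" for e
    proof -
      define V where "V = {y \<in> carr. p (y \<boxminus> x) < e}"
      have "openin (rep_topology A) V"
        unfolding V_def top openin_topology_generated_by_iff
        using ball[OF p xA that] by (rule generate_topology_on.Basis)
      moreover have "x \<in> V"
        using xA that zero_self[OF p] by (simp add: V_def)
      ultimately obtain y where "y \<in> S" "y \<in> V"
        using x unfolding cstar_closure_def in_closure_of by blast
      then show ?thesis by (auto simp: V_def)
    qed
    with xA show "x \<in> carr \<and> (\<forall>e>0. \<exists>y\<in>S. p (y \<boxminus> x) < e)" by blast
  next
    assume x: "x \<in> carr \<and> (\<forall>e>0. \<exists>y\<in>S. p (y \<boxminus> x) < e)"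
    have "\<exists>y. y \<in> S \<and> y \<in> U" if "x \<in> U" "openin (rep_topology A) U" for U
    proof -
      from that(2) have "generate_topology_on \<B> U"
        unfolding top openin_topology_generated_by_iff .
      from nbhd[OF this that(1)] obtain e where e: "e > 0" "\<forall>y\<in>carr. p (y \<boxminus> x) < e \<longrightarrow> y \<in> U"
        by blast
      with x obtain y where "y \<in> S" "p (y \<boxminus> x) < e" by blast
      with e S show ?thesis by blast
    qed
    then show "x \<in> cstar_closure A S"
      using x by (simp add: cstar_closure_def top in_closure_of carr)
  qed
qed

end

text \<open>Squaring is monotone on nonnegative reals and so commutes with \<open>max\<close>, which
  preserves the C*-identity. A sum in general does not preserve it.\<close>

lemma cstar_seminorm_max:
  assumes "star_alg A" "cstar_seminorm A p" "cstar_seminorm A q"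
  shows "cstar_seminorm A (\<lambda>x. max (p x) (q x))"
proof -
  interpret p: seminormed_star_alg A p
    using assms by (simp add: seminormed_star_alg_def seminormed_star_alg_axioms_def)
  interpret q: seminormed_star_alg A q
    using assms by (simp add: seminormed_star_alg_def seminormed_star_alg_axioms_def)
  show ?thesis
    unfolding cstar_seminorm_def
  proof (intro conjI ballI allI)
    fix x y assume xy [simp]: "x \<in> p.carr" "y \<in> p.carr"
    show "max (p (sa_add A x y)) (q (sa_add A x y)) \<le> max (p x) (q x) + max (p y) (q y)"
      using p.p_add[OF xy] q.p_add[OF xy] by linarith
    have "p x * p y \<le> max (p x) (q x) * max (p y) (q y)"
      "q x * q y \<le> max (p x) (q x) * max (p y) (q y)"
      by (intro mult_mono; simp add: le_max_iff_disj)+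
    then show "max (p (sa_mul A x y)) (q (sa_mul A x y)) \<le> max (p x) (q x) * max (p y) (q y)"
      using p.p_mul[OF xy] q.p_mul[OF xy] by linarith
  next
    fix x assume x: "x \<in> p.carr"
    show "max (p (sa_mul A (sa_star A x) x)) (q (sa_mul A (sa_star A x) x)) = (max (p x) (q x))\<^sup>2"
      unfolding p.p_star_mul[OF x] q.p_star_mul[OF x]
      using x power_mono[of "p x" "q x" 2] power_mono[of "q x" "p x" 2]
      by (cases "p x \<le> q x") (simp_all add: max_def)
  qed (simp_all add: p.p_scale q.p_scale max_mult_distrib_left le_max_iff_disj)
qed

section \<open>Algebras with a largest seminorm\<close>

locale gsa = fixes A :: "'a tsalg" assumes in_GsA: "in_GsA A"
begin

sublocale star_alg A
  using in_GsA by (simp add: star_alg_def in_GsA_def top_star_algebra_def)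

abbreviation r where "r \<equiv> largest_seminorm A"

lemma is_largest: "is_largest_seminorm A r"
proof -
  obtain s where s: "is_largest_seminorm A s" using in_GsA by (auto simp: in_GsA_def)
  have "t = s" if "is_largest_seminorm A t" for t
    using s that by (auto simp: is_largest_seminorm_def fun_eq_iff intro!: order_antisym)
  then have "r = s" unfolding largest_seminorm_def using s by (intro the_equality)
  then show ?thesis using s by simp
qed

lemma r_mem: "r \<in> cont_cstar_seminorms A"
  and le_r: "p \<in> cont_cstar_seminorms A \<Longrightarrow> p x \<le> r x"
  using is_largest by (auto simp: is_largest_seminorm_def)

sublocale seminormed_star_alg A r
  by unfold_locales (use r_mem in \<open>simp add: cont_cstar_seminorms_def\<close>)

lemma cont_r: "continuous_map (sa_top A) euclideanreal r"
  using r_mem by (simp add: cont_cstar_seminorms_def)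

lemma topspace [simp]: "topspace (sa_top A) = carr"
  and cont_add: "continuous_map (prod_topology (sa_top A) (sa_top A)) (sa_top A) (\<lambda>(x, y). x \<boxplus> y)"
  using in_GsA by (auto simp: in_GsA_def top_star_algebra_def)

lemma cstar_closure_r:
  "S \<subseteq> carr \<Longrightarrow> x \<in> cstar_closure A S \<longleftrightarrow> x \<in> carr \<and> (\<forall>e>0. \<exists>y\<in>S. r (y \<boxminus> x) < e)"
  using cstar_closure_iff[OF r_mem zero_less_one] le_r by simp

lemma openin_ball:
  assumes "a \<in> carr"
  shows "openin (sa_top A) {x \<in> carr. r (x \<boxminus> a) < e}"
proof -
  have "continuous_map (sa_top A) (sa_top A) ((\<lambda>(x, y). x \<boxplus> y) \<circ> (\<lambda>x. (x, (-1) \<odot> a)))"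
    using assms by (intro continuous_map_compose[OF _ cont_add] continuous_map_pairedI) simp_all
  then have "continuous_map (sa_top A) euclideanreal (r \<circ> (\<lambda>x. x \<boxminus> a))"
    by (intro continuous_map_compose[OF _ cont_r]) (simp add: o_def diff_eq)
  from openin_continuous_map_preimage[OF this, of "{..<e}"] show ?thesis by simp
qed

lemma r_cauchy_carr [simp]: "r_cauchy A X \<Longrightarrow> X n \<in> carr"
  by (simp add: r_cauchy_def)

lemma r_cauchy_const [simp]: "a \<in> carr \<Longrightarrow> r_cauchy A (\<lambda>n. a)"
  by (simp add: r_cauchy_def)

lemma null_diff_trans:
  assumes "\<And>n. X n \<in> carr" "\<And>n. Y n \<in> carr" "\<And>n. W n \<in> carr"
    and "(\<lambda>n. r (X n \<boxminus> Y n)) \<longlonglongrightarrow> 0" "(\<lambda>n. r (Y n \<boxminus> W n)) \<longlonglongrightarrow> 0"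
  shows "(\<lambda>n. r (X n \<boxminus> W n)) \<longlonglongrightarrow> 0"
proof (rule tendsto_sandwich[OF _ _ tendsto_const tendsto_add_zero[OF assms(4,5)]])
  show "\<forall>\<^sub>F n in sequentially. r (X n \<boxminus> W n) \<le> r (X n \<boxminus> Y n) + r (Y n \<boxminus> W n)"
    using assms by (intro always_eventually allI p_diff_triangle)
qed (use assms in simp)

text \<open>The class of \<open>X\<close> is the image of \<open>a\<close> exactly when
  \<open>X\<close> is equivalent to the constant sequence \<open>a\<close>, that is, when
  \<open>X\<close> converges to \<open>a\<close>. The limit is determined only up to the kernel of
  \<open>r\<close>.\<close>

lemma envelope_map_surj_iff:
  "envelope_map A ` carr = envelope_carrier A
    \<longleftrightarrow> (\<forall>X. r_cauchy A X \<longrightarrow> (\<exists>a\<in>carr. (\<lambda>n. r (X n \<boxminus> a)) \<longlonglongrightarrow> 0))"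
    (is "_ \<longleftrightarrow> ?complete")
proof
  assume surj: "envelope_map A ` carr = envelope_carrier A"
  show ?complete
  proof (intro allI impI)
    fix X assume X: "r_cauchy A X"
    then have "r_class A X \<in> envelope_map A ` carr"
      unfolding surj envelope_carrier_def by blast
    then obtain a where a: "a \<in> carr" "r_class A X = r_class A (\<lambda>n. a)"
      by (auto simp: envelope_map_def)
    have "X \<in> r_class A X" using X by (simp add: r_class_def)
    then have "(\<lambda>n. r (a \<boxminus> X n)) \<longlonglongrightarrow> 0" unfolding a(2) by (simp add: r_class_def)
    then show "\<exists>a\<in>carr. (\<lambda>n. r (X n \<boxminus> a)) \<longlonglongrightarrow> 0"
      using a X by (auto simp: p_diff_commute[of a])
  qed
next
  assume c: ?complete
  have "r_class A X \<in> envelope_map A ` carr" if X: "r_cauchy A X" for X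
  proof -
    obtain a where a: "a \<in> carr" "(\<lambda>n. r (X n \<boxminus> a)) \<longlonglongrightarrow> 0" using c X by blast
    then have a': "(\<lambda>n. r (a \<boxminus> X n)) \<longlonglongrightarrow> 0" using X by (simp add: p_diff_commute[of a])
    have "r_class A X = r_class A (\<lambda>n. a)"
      using null_diff_trans[OF _ _ _ a(2)] null_diff_trans[OF _ _ _ a'] a(1) X
      by (auto simp: r_class_def)
    then show ?thesis using a(1) by (auto simp: envelope_map_def)
  qed
  then show "envelope_map A ` carr = envelope_carrier A"
    by (fastforce simp: envelope_carrier_def envelope_map_def)
qed

end

lemma sa_prod_simps [simp]:
  "sa_carrier (sa_prod A B) = sa_carrier A \<times> sa_carrier B"
  "sa_add (sa_prod A B) (a, b) (a', b') = (sa_add A a a', sa_add B b b')"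
  "sa_mul (sa_prod A B) (a, b) (a', b') = (sa_mul A a a', sa_mul B b b')"
  "sa_smul (sa_prod A B) c (a, b) = (sa_smul A c a, sa_smul B c b)"
  "sa_zero (sa_prod A B) = (sa_zero A, sa_zero B)"
  "sa_star (sa_prod A B) (a, b) = (sa_star A a, sa_star B b)"
  "sa_top (sa_prod A B) = prod_topology (sa_top A) (sa_top B)"
  by (simp_all add: sa_prod_def)

lemma sa_diff_prod [simp]:
  "sa_diff (sa_prod A B) (a, b) (a', b') = (sa_diff A a a', sa_diff B b b')"
  by (simp add: sa_diff_def sa_neg_def)

section \<open>Products of two such algebras\<close>

locale gsa_pair = A: gsa A + B: gsa B for A :: "'a tsalg" and B :: "'b tsalg"
begin

abbreviation "AB \<equiv> sa_prod A B"

sublocale AB: star_alg AB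
  unfolding star_alg_def star_algebra_def Let_def
  by (simp add: A.add_ac B.add_ac A.add_neg B.add_neg A.scale_add_right B.scale_add_right
      A.scale_add_left B.scale_add_left A.mul_assoc B.mul_assoc A.mul_add B.mul_add
      A.add_mul B.add_mul A.scale_mul B.scale_mul A.mul_scale B.mul_scale
      A.star_add B.star_add A.star_scale B.star_scale A.star_mul B.star_mul)

lemma fst_seminorm: "cstar_seminorm AB (\<lambda>z. A.r (fst z))"
  by (simp add: cstar_seminorm_def A.p_scale A.p_add A.p_mul A.p_star_mul)

lemma snd_seminorm: "cstar_seminorm AB (\<lambda>z. B.r (snd z))"
  by (simp add: cstar_seminorm_def B.p_scale B.p_add B.p_mul B.p_star_mul)

text \<open>With the seminorms of the two coordinates, \<open>approximating_sequence\<close>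
  approximates in \<open>B\<close> while keeping the steps in \<open>A\<close> summable.\<close>

sublocale two_seminorms AB "\<lambda>z. A.r (fst z)" "\<lambda>z. B.r (snd z)"
  by unfold_locales (fact fst_seminorm snd_seminorm)+

definition prod_norm :: "'a \<times> 'b \<Rightarrow> real" where
  "prod_norm z = (if z \<in> AB.carr then max (A.r (fst z)) (B.r (snd z)) else 0)"

lemma prod_norm_mem: "prod_norm \<in> cont_cstar_seminorms AB"
proof -
  have "cstar_seminorm AB (\<lambda>z. max (A.r (fst z)) (B.r (snd z)))"
    by (intro cstar_seminorm_max AB.star_alg_axioms p.seminorm q.seminorm)
  moreover have "continuous_map (sa_top AB) euclideanreal
      (\<lambda>z. max ((A.r \<circ> fst) z) ((B.r \<circ> snd) z))"
    unfolding sa_prod_simps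
    by (intro continuous_map_real_max continuous_map_compose[OF continuous_map_fst A.cont_r]
        continuous_map_compose[OF continuous_map_snd B.cont_r])
  then have "continuous_map (sa_top AB) euclideanreal prod_norm"
    by (rule continuous_map_eq) (simp add: prod_norm_def)
  ultimately show ?thesis
    by (subst (asm) AB.cstar_seminorm_cong[where q = prod_norm])
      (auto simp: cont_cstar_seminorms_def prod_norm_def)
qed

text \<open>The pullback along the continuous *-homomorphism sending \<open>a\<close> to
  \<open>(a, 0)\<close> makes \<open>p\<close> comparable with the largest seminorm of
  \<open>A\<close>.\<close>

lemma restrict_fst_mem:
  assumes "p \<in> cont_cstar_seminorms AB"
  shows "(\<lambda>a. if a \<in> A.carr then p (a, B.zero) else 0) \<in> cont_cstar_seminorms A" (is "?q \<in> _")
proof -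
  interpret p: seminormed_star_alg AB p
    by unfold_locales (use assms in \<open>simp add: cont_cstar_seminorms_def\<close>)
  have "cstar_seminorm A (\<lambda>a. p (a, B.zero))"
    using p.p_scale[of "(_, B.zero)"] p.p_add[of "(_, B.zero)" "(_, B.zero)"]
      p.p_mul[of "(_, B.zero)" "(_, B.zero)"] p.p_star_mul[of "(_, B.zero)"]
    by (auto simp: cstar_seminorm_def)
  then have "cstar_seminorm A ?q"
    by (subst (asm) A.cstar_seminorm_cong[where q = ?q]) auto
  moreover have "continuous_map (sa_top A) euclideanreal (p \<circ> (\<lambda>a. (a, B.zero)))"
    using assms
    by (intro continuous_map_compose[of _ "sa_top AB"])
      (auto intro!: continuous_map_pairedI simp: cont_cstar_seminorms_def)
  then have "continuous_map (sa_top A) euclideanreal ?q"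
    by (rule continuous_map_eq) simp
  ultimately show ?thesis by (simp add: cont_cstar_seminorms_def)
qed

lemma restrict_snd_mem:
  assumes "p \<in> cont_cstar_seminorms AB"
  shows "(\<lambda>b. if b \<in> B.carr then p (A.zero, b) else 0) \<in> cont_cstar_seminorms B" (is "?q \<in> _")
proof -
  interpret p: seminormed_star_alg AB p
    by unfold_locales (use assms in \<open>simp add: cont_cstar_seminorms_def\<close>)
  have "cstar_seminorm B (\<lambda>b. p (A.zero, b))"
    using p.p_scale[of "(A.zero, _)"] p.p_add[of "(A.zero, _)" "(A.zero, _)"]
      p.p_mul[of "(A.zero, _)" "(A.zero, _)"] p.p_star_mul[of "(A.zero, _)"]
    by (auto simp: cstar_seminorm_def)
  then have "cstar_seminorm B ?q"
    by (subst (asm) B.cstar_seminorm_cong[where q = ?q]) auto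
  moreover have "continuous_map (sa_top B) euclideanreal (p \<circ> (\<lambda>b. (A.zero, b)))"
    using assms
    by (intro continuous_map_compose[of _ "sa_top AB"])
      (auto intro!: continuous_map_pairedI simp: cont_cstar_seminorms_def)
  then have "continuous_map (sa_top B) euclideanreal ?q"
    by (rule continuous_map_eq) simp
  ultimately show ?thesis by (simp add: cont_cstar_seminorms_def)
qed

text \<open>Split \<open>(a, b)\<close> as \<open>(a, 0) + (0, b)\<close> and bound each summand by
  a largest seminorm. The factor 2 does not affect closures.\<close>

lemma seminorm_le_prod_norm:
  assumes p: "p \<in> cont_cstar_seminorms AB" and x: "x \<in> AB.carr"
  shows "p x \<le> 2 * prod_norm x"
proof -
  interpret p: seminormed_star_alg AB p
    by unfold_locales (use p in \<open>simp add: cont_cstar_seminorms_def\<close>)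
  obtain a b where x_eq: "x = (a, b)" and a: "a \<in> A.carr" and b: "b \<in> B.carr" using x by auto
  have "p x \<le> p (a, B.zero) + p (A.zero, b)"
    using p.p_add[of "(a, B.zero)" "(A.zero, b)"] a b by (simp add: x_eq)
  also have "\<dots> \<le> A.r a + B.r b"
    using A.le_r[OF restrict_fst_mem[OF p], of a] B.le_r[OF restrict_snd_mem[OF p], of b] a b
    by simp
  also have "\<dots> \<le> 2 * prod_norm x" using a b by (simp add: prod_norm_def x_eq max_def)
  finally show ?thesis .
qed

lemma cstar_closure_prod_iff:
  assumes "S \<subseteq> AB.carr"
  shows "(a, b) \<in> cstar_closure AB S \<longleftrightarrow> a \<in> A.carr \<and> b \<in> B.carr \<and>
    (\<forall>e>0. \<exists>(a', b')\<in>S. A.r (sa_diff A a' a) < e \<and> B.r (sa_diff B b' b) < e)"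
proof -
  have iff: "(a, b) \<in> cstar_closure AB S \<longleftrightarrow> (a, b) \<in> AB.carr \<and>
      (\<forall>e>0. \<exists>y\<in>S. prod_norm (AB.diff y (a, b)) < e)"
    by (rule AB.cstar_closure_iff[where K = 2, OF prod_norm_mem _ _ assms])
      (simp_all add: seminorm_le_prod_norm)
  have "prod_norm (AB.diff y (a, b)) < e \<longleftrightarrow>
      (case y of (a', b') \<Rightarrow> A.r (sa_diff A a' a) < e \<and> B.r (sa_diff B b' b) < e)"
    if "a \<in> A.carr" "b \<in> B.carr" "y \<in> S" for y e
    using that assms by (cases y) (auto simp: prod_norm_def)
  then have "(\<exists>y\<in>S. prod_norm (AB.diff y (a, b)) < e) \<longleftrightarrow>
      (\<exists>(a', b')\<in>S. A.r (sa_diff A a' a) < e \<and> B.r (sa_diff B b' b) < e)"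
    if "a \<in> A.carr" "b \<in> B.carr" for e
    using that by (intro bex_cong refl)
  then show ?thesis
    unfolding iff by auto
qed

lemma snd_cstar_closure:
  assumes complete: "\<And>X. r_cauchy A X \<Longrightarrow> \<exists>a\<in>A.carr. (\<lambda>n. A.r (sa_diff A (X n) a)) \<longlonglongrightarrow> 0"
    and S: "star_subalgebra AB S"
  shows "snd ` cstar_closure AB S = cstar_closure B (snd ` S)"
proof
  have SA: "S \<subseteq> AB.carr" using S by (simp add: star_subalgebra_def)
  then have SB: "snd ` S \<subseteq> B.carr" by auto
  show "snd ` cstar_closure AB S \<subseteq> cstar_closure B (snd ` S)"
    using cstar_closure_prod_iff[OF SA] B.cstar_closure_r[OF SB] by fastforce
  show "cstar_closure B (snd ` S) \<subseteq> snd ` cstar_closure AB S"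
  proof
    fix b assume "b \<in> cstar_closure B (snd ` S)"
    then have b: "b \<in> B.carr" "\<And>e. 0 < e \<Longrightarrow> \<exists>y\<in>snd ` S. B.r (sa_diff B y b) < e"
      using B.cstar_closure_r[OF SB] by auto
    \<comment> \<open>The second seminorm sees only the coordinate in \<open>B\<close>, so
      \<open>A.zero\<close> is a mere placeholder.\<close>
    have "\<exists>u\<in>S. B.r (snd (AB.diff u (A.zero, b))) < e" if "0 < e" for e
      using b(2)[OF that] by force
    then obtain U where U: "\<And>n. U n \<in> S"
      "\<And>n. B.r (snd (AB.diff (U n) (A.zero, b))) < (1/2) ^ n"
      "\<And>n. A.r (fst (AB.diff (U (Suc n)) (U n))) \<le> 8 * (1/2) ^ n"
      using approximating_sequence[OF S, of "(A.zero, b)"] b(1) by auto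
    define X Y where "X = (\<lambda>n. fst (U n))" and "Y = (\<lambda>n. snd (U n))"
    have XY: "(X n, Y n) \<in> S" and X [simp]: "X n \<in> A.carr" and Y: "B.r (sa_diff B (Y n) b) < (1/2) ^ n"
      and step: "A.r (sa_diff A (X (Suc n)) (X n)) \<le> 8 * (1/2) ^ n" for n
    proof -
      show "(X n, Y n) \<in> S" using U(1) by (simp add: X_def Y_def)
      then show "X n \<in> A.carr" using SA by auto
      show "B.r (sa_diff B (Y n) b) < (1/2) ^ n"
        using U(2)[of n] by (cases "U n") (simp add: Y_def)
      show "A.r (sa_diff A (X (Suc n)) (X n)) \<le> 8 * (1/2) ^ n"
        using U(3)[of n] by (cases "U n"; cases "U (Suc n)") (simp add: X_def)
    qed
    \<comment> \<open>Steps of size \<open>8 * (1/2) ^ j\<close> sum to this value from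
      \<open>n\<close> on; keeping the factor \<open>1 - (1/2) ^ k\<close> lets the induction close
      exactly.\<close>
    have tail: "A.r (sa_diff A (X (n + k)) (X n)) \<le> 16 * (1/2) ^ n * (1 - (1/2) ^ k)" for n k
    proof (induction k)
      case (Suc k)
      have "A.r (sa_diff A (X (n + Suc k)) (X n))
          \<le> A.r (sa_diff A (X (Suc (n + k))) (X (n + k))) + A.r (sa_diff A (X (n + k)) (X n))"
        using A.p_diff_triangle[of "X (Suc (n + k))" "X (n + k)" "X n"] by simp
      also have "\<dots> \<le> 8 * (1/2) ^ (n + k) + 16 * (1/2) ^ n * (1 - (1/2) ^ k)"
        using Suc step by (intro add_mono)
      also have "\<dots> = 16 * (1/2) ^ n * (1 - (1/2) ^ Suc k)"
        by (simp add: power_add algebra_simps)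
      finally show ?case .
    qed simp
    have tail': "A.r (sa_diff A (X m) (X n)) \<le> 16 * (1/2) ^ N" if "N \<le> n" "n \<le> m" for m n N
    proof -
      have "A.r (sa_diff A (X m) (X n)) \<le> 16 * (1/2) ^ n * (1 - (1/2) ^ (m - n))"
        using tail[of n "m - n"] that by simp
      also have "\<dots> \<le> 16 * (1/2) ^ N * 1"
        using that by (intro mult_mono) (auto intro: power_decreasing simp: power_le_one)
      finally show ?thesis by simp
    qed
    have "r_cauchy A X"
      unfolding r_cauchy_def
    proof (intro conjI allI impI)
      fix e :: real assume "0 < e"
      then obtain N where N: "(1/2) ^ N < e / 16"
        using real_arch_pow_inv[of "e / 16" "1/2"] by auto
      have "A.r (sa_diff A (X m) (X n)) < e" if "N \<le> m" "N \<le> n" for m n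
        using tail'[of N n m] tail'[of N m n] that N A.p_diff_commute[of "X m" "X n"]
        by (cases "n \<le> m") auto
      then show "\<exists>N. \<forall>m\<ge>N. \<forall>n\<ge>N. A.r (sa_diff A (X m) (X n)) < e" by blast
    qed simp
    from complete[OF this] obtain a where a: "a \<in> A.carr" "(\<lambda>n. A.r (sa_diff A (X n) a)) \<longlonglongrightarrow> 0"
      by blast
    \<comment> \<open>Both coordinates of \<open>U n\<close> converge, so a single late index serves
      for \<open>a\<close> and \<open>b\<close> together.\<close>
    have "\<exists>(a', b')\<in>S. A.r (sa_diff A a' a) < e \<and> B.r (sa_diff B b' b) < e" if "0 < e" for e
    proof -
      have "\<forall>\<^sub>F n in sequentially. A.r (sa_diff A (X n) a) < e"
        using a(2) that by (rule order_tendstoD)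
      moreover have "\<forall>\<^sub>F n in sequentially. (1/2 :: real) ^ n < e"
        using that by (intro order_tendstoD[OF LIMSEQ_realpow_zero]) auto
      ultimately have "\<forall>\<^sub>F n in sequentially. A.r (sa_diff A (X n) a) < e \<and> (1/2) ^ n < e"
        by (rule eventually_conj)
      then obtain n where "A.r (sa_diff A (X n) a) < e" "(1/2) ^ n < e"
        by (auto dest: eventually_happens)
      then show ?thesis using XY[of n] Y[of n] by force
    qed
    then have "(a, b) \<in> cstar_closure AB S"
      using cstar_closure_prod_iff[OF SA] a(1) b(1) by blast
    then show "b \<in> snd ` cstar_closure AB S" by force
  qed
qed

end

section \<open>The algebra of Cauchy sequences\<close>

context seminormed_star_alg
begin

definition seminorm_topology :: "'a topology" where
  "seminorm_topology =
    topology (\<lambda>U. U \<subseteq> carr \<and> (\<forall>x\<in>U. \<exists>e>0. \<forall>y\<in>carr. p (y \<boxminus> x) < e \<longrightarrow> y \<in> U))"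

lemma openin_seminorm_topology:
  "openin seminorm_topology U \<longleftrightarrow>
    U \<subseteq> carr \<and> (\<forall>x\<in>U. \<exists>e>0. \<forall>y\<in>carr. p (y \<boxminus> x) < e \<longrightarrow> y \<in> U)"
proof -
  have "istopology (\<lambda>U. U \<subseteq> carr \<and> (\<forall>x\<in>U. \<exists>e>0. \<forall>y\<in>carr. p (y \<boxminus> x) < e \<longrightarrow> y \<in> U))"
    (is "istopology ?P")
    unfolding istopology_def
  proof (intro conjI allI impI)
    fix U V assume U: "?P U" and V: "?P V"
    then show "U \<inter> V \<subseteq> carr" by blast
    show "\<forall>x\<in>U \<inter> V. \<exists>e>0. \<forall>y\<in>carr. p (y \<boxminus> x) < e \<longrightarrow> y \<in> U \<inter> V"
    proof
      fix x assume x: "x \<in> U \<inter> V"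
      obtain d where "d > 0" "\<forall>y\<in>carr. p (y \<boxminus> x) < d \<longrightarrow> y \<in> U" using U x by blast
      moreover obtain e where "e > 0" "\<forall>y\<in>carr. p (y \<boxminus> x) < e \<longrightarrow> y \<in> V" using V x by blast
      ultimately show "\<exists>e>0. \<forall>y\<in>carr. p (y \<boxminus> x) < e \<longrightarrow> y \<in> U \<inter> V"
        by (intro exI[of _ "min d e"]) auto
    qed
  next
    fix \<U> assume \<U>: "\<forall>U\<in>\<U>. ?P U"
    then show "\<Union>\<U> \<subseteq> carr" by blast
    show "\<forall>x\<in>\<Union>\<U>. \<exists>e>0. \<forall>y\<in>carr. p (y \<boxminus> x) < e \<longrightarrow> y \<in> \<Union>\<U>"
    proof
      fix x assume "x \<in> \<Union>\<U>"
      then obtain U where U: "U \<in> \<U>" "x \<in> U" by blast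
      then obtain e where "e > 0" "\<forall>y\<in>carr. p (y \<boxminus> x) < e \<longrightarrow> y \<in> U" using \<U> by blast
      with U show "\<exists>e>0. \<forall>y\<in>carr. p (y \<boxminus> x) < e \<longrightarrow> y \<in> \<Union>\<U>" by blast
    qed
  qed
  then show ?thesis by (simp add: seminorm_topology_def)
qed

lemma topspace_seminorm_topology [simp]: "topspace seminorm_topology = carr"
proof
  show "topspace seminorm_topology \<subseteq> carr"
    using openin_seminorm_topology openin_topspace by blast
  have "openin seminorm_topology carr"
    unfolding openin_seminorm_topology using zero_less_one by blast
  then show "carr \<subseteq> topspace seminorm_topology" by (rule openin_subset)
qed

lemma openin_seminorm_ball:
  assumes a: "a \<in> carr"
  shows "openin seminorm_topology {x \<in> carr. p (x \<boxminus> a) < e}"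
  unfolding openin_seminorm_topology
proof (intro conjI ballI)
  fix x assume "x \<in> {x \<in> carr. p (x \<boxminus> a) < e}"
  then have x: "x \<in> carr" "p (x \<boxminus> a) < e" by auto
  have "p (y \<boxminus> a) < e" if y: "y \<in> carr" "p (y \<boxminus> x) < e - p (x \<boxminus> a)" for y
    using p_diff_triangle[OF y(1) x(1) a] y(2) by simp
  then show "\<exists>d>0. \<forall>y\<in>carr. p (y \<boxminus> x) < d \<longrightarrow> y \<in> {x \<in> carr. p (x \<boxminus> a) < e}"
    using x by (intro exI[of _ "e - p (x \<boxminus> a)"]) auto
qed auto

lemma continuous_map_seminorm_topologyI:
  assumes g: "\<And>x. x \<in> topspace Z \<Longrightarrow> g x \<in> carr"
    and cont: "\<And>x e. x \<in> topspace Z \<Longrightarrow> 0 < e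
      \<Longrightarrow> \<exists>V. openin Z V \<and> x \<in> V \<and> (\<forall>y\<in>V. p (g y \<boxminus> g x) < e)"
  shows "continuous_map Z seminorm_topology g"
  unfolding continuous_map_def
proof (intro conjI allI impI)
  show "g \<in> topspace Z \<rightarrow> topspace seminorm_topology" using g by simp
  fix U assume U: "openin seminorm_topology U"
  show "openin Z {x \<in> topspace Z. g x \<in> U}"
  proof (subst openin_subopen, intro ballI)
    fix x assume "x \<in> {x \<in> topspace Z. g x \<in> U}"
    then have x: "x \<in> topspace Z" "g x \<in> U" by auto
    obtain e where e: "e > 0" "\<forall>y\<in>carr. p (y \<boxminus> g x) < e \<longrightarrow> y \<in> U"
      using U x(2) unfolding openin_seminorm_topology by blast
    obtain V where V: "openin Z V" "x \<in> V" "\<forall>y\<in>V. p (g y \<boxminus> g x) < e"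
      using cont[OF x(1) e(1)] by blast
    have "V \<subseteq> {x \<in> topspace Z. g x \<in> U}"
      using V e g openin_subset[OF V(1)] by blast
    then show "\<exists>T. openin Z T \<and> x \<in> T \<and> T \<subseteq> {x \<in> topspace Z. g x \<in> U}"
      using V by blast
  qed
qed

lemma continuous_map_seminorm: "continuous_map seminorm_topology euclideanreal p"
  unfolding continuous_map_def
proof (intro conjI allI impI)
  fix U :: "real set" assume U: "openin euclideanreal U"
  show "openin seminorm_topology {x \<in> topspace seminorm_topology. p x \<in> U}"
    unfolding openin_seminorm_topology
  proof (intro conjI ballI)
    fix x assume "x \<in> {x \<in> topspace seminorm_topology. p x \<in> U}"
    then have x: "x \<in> carr" "p x \<in> U" by auto
    obtain e where e: "e > 0" "\<And>s. \<bar>s - p x\<bar> < e \<Longrightarrow> s \<in> U"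
      using U x(2) by (auto simp: open_dist dist_real_def)
    have "p y \<in> U" if "y \<in> carr" "p (y \<boxminus> x) < e" for y
      using abs_p_diff_le[OF that(1) x(1)] that(2) by (intro e(2)) simp
    then show "\<exists>e>0. \<forall>y\<in>carr. p (y \<boxminus> x) < e
        \<longrightarrow> y \<in> {x \<in> topspace seminorm_topology. p x \<in> U}"
      using e(1) by auto
  qed auto
qed auto

lemma mul_close:
  assumes x: "x \<in> carr" and y: "y \<in> carr" and "0 < e"
  obtains d where "0 < d" "\<And>x' y'. x' \<in> carr \<Longrightarrow> y' \<in> carr \<Longrightarrow> p (x' \<boxminus> x) < d \<Longrightarrow> p (y' \<boxminus> y) < d
    \<Longrightarrow> p (x' \<boxtimes> y' \<boxminus> x \<boxtimes> y) < e"
proof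
  \<comment> \<open>The cap 1 gives \<open>p y' \<le> p y + 1\<close>, so the two summands amount to
    at most \<open>d * (p x + p y + 1)\<close>; the 2 in the denominator makes the inequality
    strict.\<close>
  define d where "d = min 1 (e / (p x + p y + 2))"
  have pos: "0 < p x + p y + 2" using x y by (simp add: add_nonneg_pos)
  show d: "0 < d" using pos \<open>0 < e\<close> by (simp add: d_def)
  have "d \<le> e / (p x + p y + 2)" by (simp add: d_def)
  then have de: "d * (p x + p y + 2) \<le> e" using pos by (simp add: pos_le_divide_eq)
  fix x' y' assume x': "x' \<in> carr" and y': "y' \<in> carr" and close: "p (x' \<boxminus> x) < d" "p (y' \<boxminus> y) < d"
  have "p y' \<le> p y + 1"
    using p_le_add_diff[OF y' y] close by (simp add: d_def)
  have "p (x' \<boxtimes> y' \<boxminus> x \<boxtimes> y) = p ((x' \<boxminus> x) \<boxtimes> y' \<boxplus> x \<boxtimes> (y' \<boxminus> y))"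
    using x y x' y' by (simp add: mul_diff_mul)
  also have "\<dots> \<le> p ((x' \<boxminus> x) \<boxtimes> y') + p (x \<boxtimes> (y' \<boxminus> y))"
    using x y x' y' by (intro p_add) auto
  also have "\<dots> \<le> p (x' \<boxminus> x) * p y' + p x * p (y' \<boxminus> y)"
    using x y x' y' by (intro add_mono p_mul) auto
  also have "\<dots> \<le> d * (p y + 1) + p x * d"
    using x y x' y' close d \<open>p y' \<le> p y + 1\<close> by (intro add_mono mult_mono) auto
  also have "\<dots> < d * (p x + p y + 2)"
    using d by (simp add: algebra_simps)
  finally show "p (x' \<boxtimes> y' \<boxminus> x \<boxtimes> y) < e" using de by simp
qed

lemma continuous_map_prod_seminormI:
  assumes g: "\<And>x y. x \<in> carr \<Longrightarrow> y \<in> carr \<Longrightarrow> g x y \<in> carr"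
    and cont: "\<And>x y e. x \<in> carr \<Longrightarrow> y \<in> carr \<Longrightarrow> 0 < e \<Longrightarrow> \<exists>d>0. \<forall>x'\<in>carr. \<forall>y'\<in>carr.
      p (x' \<boxminus> x) < d \<longrightarrow> p (y' \<boxminus> y) < d \<longrightarrow> p (g x' y' \<boxminus> g x y) < e"
  shows "continuous_map (prod_topology seminorm_topology seminorm_topology) seminorm_topology
    (\<lambda>(x, y). g x y)"
proof (rule continuous_map_seminorm_topologyI)
  fix z :: "'a \<times> 'a" and e :: real
  assume "z \<in> topspace (prod_topology seminorm_topology seminorm_topology)" and e: "0 < e"
  then obtain x y where z: "z = (x, y)" and x: "x \<in> carr" and y: "y \<in> carr" by auto
  from cont[OF x y e] obtain d where d: "d > 0" "\<And>x' y'. x'\<in>carr \<Longrightarrow> y'\<in>carr \<Longrightarrow>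
      p (x' \<boxminus> x) < d \<Longrightarrow> p (y' \<boxminus> y) < d \<Longrightarrow> p (g x' y' \<boxminus> g x y) < e" by blast
  define V where "V = {x' \<in> carr. p (x' \<boxminus> x) < d} \<times> {y' \<in> carr. p (y' \<boxminus> y) < d}"
  have "openin (prod_topology seminorm_topology seminorm_topology) V"
    unfolding V_def openin_prod_Times_iff using x y openin_seminorm_ball by blast
  moreover have "z \<in> V" using x y d(1) by (simp add: V_def z)
  moreover have "\<forall>v\<in>V. p ((case v of (x, y) \<Rightarrow> g x y) \<boxminus> (case z of (x, y) \<Rightarrow> g x y)) < e"
    using d(2) by (auto simp: V_def z)
  ultimately show "\<exists>V. openin (prod_topology seminorm_topology seminorm_topology) V \<and> z \<in> V \<and>
      (\<forall>v\<in>V. p ((case v of (x, y) \<Rightarrow> g x y) \<boxminus> (case z of (x, y) \<Rightarrow> g x y)) < e)" by blast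
qed (use g in auto)

lemma continuous_map_isometric:
  assumes "\<And>x. x \<in> carr \<Longrightarrow> g x \<in> carr"
    and "\<And>x y. x \<in> carr \<Longrightarrow> y \<in> carr \<Longrightarrow> p (g x \<boxminus> g y) = p (x \<boxminus> y)"
  shows "continuous_map seminorm_topology seminorm_topology g"
proof (rule continuous_map_seminorm_topologyI)
  fix x e assume "x \<in> topspace seminorm_topology" "0 < (e::real)"
  then show "\<exists>V. openin seminorm_topology V \<and> x \<in> V \<and> (\<forall>y\<in>V. p (g y \<boxminus> g x) < e)"
    using assms by (intro exI[of _ "{y \<in> carr. p (y \<boxminus> x) < e}"]) (auto simp: openin_seminorm_ball)
qed (use assms in simp)

lemma top_star_algebra_seminorm:
  assumes "sa_top A = seminorm_topology"
  shows "top_star_algebra A"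
  unfolding top_star_algebra_def assms
proof (intro conjI star_algebra topspace_seminorm_topology)
  show "continuous_map (prod_topology seminorm_topology seminorm_topology) seminorm_topology
      (\<lambda>(x, y). x \<boxplus> y)"
  proof (rule continuous_map_prod_seminormI)
    fix x y and e :: real assume xy: "x \<in> carr" "y \<in> carr" and e: "0 < e"
    have "p (x' \<boxplus> y' \<boxminus> (x \<boxplus> y)) < e"
      if "x' \<in> carr" "y' \<in> carr" "p (x' \<boxminus> x) < e / 2" "p (y' \<boxminus> y) < e / 2" for x' y'
      using p_add[of "x' \<boxminus> x" "y' \<boxminus> y"] that xy by (simp add: add_diff_add)
    then show "\<exists>d>0. \<forall>x'\<in>carr. \<forall>y'\<in>carr. p (x' \<boxminus> x) < d \<longrightarrow> p (y' \<boxminus> y) < d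
        \<longrightarrow> p (x' \<boxplus> y' \<boxminus> (x \<boxplus> y)) < e"
      using e by (intro exI[of _ "e / 2"]) auto
  qed simp
  show "continuous_map (prod_topology seminorm_topology seminorm_topology) seminorm_topology
      (\<lambda>(x, y). x \<boxtimes> y)"
  proof (rule continuous_map_prod_seminormI)
    fix x y and e :: real assume "x \<in> carr" "y \<in> carr" "0 < e"
    from mul_close[OF this] show "\<exists>d>0. \<forall>x'\<in>carr. \<forall>y'\<in>carr. p (x' \<boxminus> x) < d
        \<longrightarrow> p (y' \<boxminus> y) < d \<longrightarrow> p (x' \<boxtimes> y' \<boxminus> x \<boxtimes> y) < e" by metis
  qed simp
  show "continuous_map seminorm_topology seminorm_topology (sa_neg A)"
    by (rule continuous_map_isometric)
      (simp_all add: sa_neg_def scale_diff[symmetric] p_scale)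
  show "continuous_map seminorm_topology seminorm_topology star"
    by (rule continuous_map_isometric) (simp_all add: star_diff[symmetric])
qed

text \<open>Continuity at zero gives a \<open>p\<close>-ball on which \<open>q\<close> is below 1.
  Scaling \<open>x\<close> to \<open>q\<close>-value exactly 1 moves it out of that ball, which
  bounds \<open>p x\<close> from below.\<close>

lemma continuous_seminorm_bounded:
  assumes q: "cstar_seminorm A q" "continuous_map seminorm_topology euclideanreal q"
  obtains K where "\<And>x. x \<in> carr \<Longrightarrow> q x \<le> K * p x"
proof -
  interpret q: seminormed_star_alg A q by unfold_locales (rule q)
  have "openin seminorm_topology {x \<in> carr. q x < 1}"
    using openin_continuous_map_preimage[OF q(2), of "{..<1}"] by simp
  moreover have "zero \<in> {x \<in> carr. q x < 1}" by simp
  ultimately obtain e where e: "e > 0" "\<And>y. y \<in> carr \<Longrightarrow> p (y \<boxminus> zero) < e \<Longrightarrow> q y < 1"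
    unfolding openin_seminorm_topology by blast
  have "q x \<le> (2 / e) * p x" if x: "x \<in> carr" for x
  proof (cases "q x = 0")
    case False
    then have qx: "0 < q x" using x by (simp add: less_le)
    have "\<not> p (complex_of_real (1 / q x) \<odot> x) < e"
      using e(2)[of "complex_of_real (1 / q x) \<odot> x"] x qx by (auto simp: q.p_scale norm_divide)
    then have "e \<le> p x / q x" using x qx by (simp add: p_scale norm_divide)
    then have "e * q x \<le> p x" using qx by (simp add: pos_le_divide_eq)
    then have "q x \<le> p x / e" using e(1) by (simp add: field_simps)
    also have "\<dots> \<le> (2 / e) * p x" using e(1) x by (simp add: field_simps)
    finally show ?thesis .
  qed (use x e in simp)
  then show thesis by (rule that)
qed

end

section \<open>Cauchy sequences and their limit seminorm\<close>

context gsa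
begin

text \<open>One criterion for all operations; for the unary ones \<open>X\<close> and
  \<open>Y\<close> coincide.\<close>

lemma r_cauchyI:
  assumes X: "r_cauchy A X" and Y: "r_cauchy A Y" and Z: "\<And>n. Z n \<in> carr"
    and "0 < K"
    and le: "\<And>m n. r (Z m \<boxminus> Z n) \<le> K * (r (X m \<boxminus> X n) + r (Y m \<boxminus> Y n))"
  shows "r_cauchy A Z"
  unfolding r_cauchy_def
proof (intro conjI allI impI Z)
  fix e :: real assume "0 < e"
  then have e: "0 < e / (2 * K)" using \<open>0 < K\<close> by simp
  obtain M N where M: "\<forall>m\<ge>M. \<forall>n\<ge>M. r (X m \<boxminus> X n) < e / (2 * K)"
    and N: "\<forall>m\<ge>N. \<forall>n\<ge>N. r (Y m \<boxminus> Y n) < e / (2 * K)"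
    using X Y e unfolding r_cauchy_def by meson
  have "r (Z m \<boxminus> Z n) < e" if "max M N \<le> m" "max M N \<le> n" for m n
  proof -
    have "r (X m \<boxminus> X n) + r (Y m \<boxminus> Y n) < e / (2 * K) + e / (2 * K)"
      using M N that by (intro add_strict_mono) auto
    then have "K * (r (X m \<boxminus> X n) + r (Y m \<boxminus> Y n)) < K * (e / (2 * K) + e / (2 * K))"
      using \<open>0 < K\<close> by (rule mult_strict_left_mono)
    then show ?thesis using le[of m n] \<open>0 < K\<close> by simp
  qed
  then show "\<exists>N. \<forall>m\<ge>N. \<forall>n\<ge>N. r (Z m \<boxminus> Z n) < e" by blast
qed

text \<open>The norm of the completion, evaluated on a representing sequence.\<close>

definition r_lim :: "(nat \<Rightarrow> 'a) \<Rightarrow> real" where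
  "r_lim X = lim (\<lambda>n. r (X n))"

lemma r_cauchy_tendsto:
  assumes "r_cauchy A X"
  shows "(\<lambda>n. r (X n)) \<longlonglongrightarrow> r_lim X"
proof -
  have "Cauchy (\<lambda>n. r (X n))"
    unfolding Cauchy_def dist_real_def
  proof (intro allI impI)
    fix e :: real assume "0 < e"
    then obtain N where "\<forall>m\<ge>N. \<forall>n\<ge>N. r (X m \<boxminus> X n) < e" using assms by (auto simp: r_cauchy_def)
    then show "\<exists>N. \<forall>m\<ge>N. \<forall>n\<ge>N. \<bar>r (X m) - r (X n)\<bar> < e"
      using assms abs_p_diff_le by (meson order_le_less_trans r_cauchy_carr)
  qed
  then show ?thesis
    unfolding r_lim_def by (intro convergent_LIMSEQ_iff[THEN iffD1] Cauchy_convergent)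
qed

lemma r_cauchy_bounded:
  assumes "r_cauchy A X"
  obtains K where "0 < K" "\<And>n. r (X n) \<le> K"
proof -
  have "Bseq (\<lambda>n. r (X n))"
    using r_cauchy_tendsto[OF assms] convergentI convergent_imp_Bseq by blast
  then obtain K where "0 < K" "\<And>n. norm (r (X n)) \<le> K" by (auto simp: Bseq_def)
  then show thesis using that[of K] by (metis abs_le_D1 real_norm_def)
qed

lemma r_cauchy_ops [simp]:
  assumes X: "r_cauchy A X" and Y: "r_cauchy A Y"
  shows "r_cauchy A (\<lambda>n. X n \<boxplus> Y n)" "r_cauchy A (\<lambda>n. X n \<boxtimes> Y n)"
    "r_cauchy A (\<lambda>n. c \<odot> X n)" "r_cauchy A (\<lambda>n. star (X n))"
proof -
  show "r_cauchy A (\<lambda>n. X n \<boxplus> Y n)"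
    using X Y by (intro r_cauchyI[OF X Y, of _ 1]) (auto simp: add_diff_add intro: p_add)
  \<comment> \<open>Multiplication is Lipschitz only on bounded sets, and Cauchy sequences are
    bounded.\<close>
  obtain K where K: "0 < K" "\<And>n. r (X n) \<le> K" by (metis r_cauchy_bounded[OF X])
  obtain L where L: "0 < L" "\<And>n. r (Y n) \<le> L" by (metis r_cauchy_bounded[OF Y])
  show "r_cauchy A (\<lambda>n. X n \<boxtimes> Y n)"
  proof (rule r_cauchyI[OF X Y, of _ "K + L"])
    fix m n
    have "r (X m \<boxtimes> Y m \<boxminus> X n \<boxtimes> Y n) = r ((X m \<boxminus> X n) \<boxtimes> Y m \<boxplus> X n \<boxtimes> (Y m \<boxminus> Y n))"
      using X Y by (simp add: mul_diff_mul)
    also have "\<dots> \<le> r ((X m \<boxminus> X n) \<boxtimes> Y m) + r (X n \<boxtimes> (Y m \<boxminus> Y n))"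
      using X Y by (intro p_add) auto
    also have "\<dots> \<le> r (X m \<boxminus> X n) * r (Y m) + r (X n) * r (Y m \<boxminus> Y n)"
      using X Y by (intro add_mono p_mul) auto
    also have "\<dots> \<le> r (X m \<boxminus> X n) * (K + L) + (K + L) * r (Y m \<boxminus> Y n)"
      using X Y K L by (intro add_mono mult_mono) (auto intro: add_increasing add_increasing2 less_imp_le)
    finally show "r (X m \<boxtimes> Y m \<boxminus> X n \<boxtimes> Y n) \<le> (K + L) * (r (X m \<boxminus> X n) + r (Y m \<boxminus> Y n))"
      by (simp add: algebra_simps)
  qed (use X Y K L in auto)
  \<comment> \<open>The summand 1 keeps the constant positive when \<open>c = 0\<close>.\<close>
  show "r_cauchy A (\<lambda>n. c \<odot> X n)"
    using X by (intro r_cauchyI[OF X X, of _ "cmod c + 1"])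
      (auto simp: scale_diff[symmetric] p_scale add_nonneg_pos intro: mult_mono)
  show "r_cauchy A (\<lambda>n. star (X n))"
    using X by (intro r_cauchyI[OF X X, of _ 1]) (auto simp: star_diff[symmetric])
qed

lemma r_cauchy_diff [simp]:
  "r_cauchy A X \<Longrightarrow> r_cauchy A Y \<Longrightarrow> r_cauchy A (\<lambda>n. X n \<boxminus> Y n)"
  by (simp add: diff_eq r_cauchy_ops(1)[OF _ r_cauchy_ops(3)])

lemma r_lim_const [simp]: "r_lim (\<lambda>n. a) = r a"
  by (simp add: r_lim_def)

lemma r_lim_eqI: "(\<lambda>n. r (X n)) \<longlonglongrightarrow> l \<Longrightarrow> r_lim X = l"
  unfolding r_lim_def by (rule limI)

lemma r_lim_cstar:
  assumes X: "r_cauchy A X" and Y: "r_cauchy A Y"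
  shows "0 \<le> r_lim X" "r_lim (\<lambda>n. c \<odot> X n) = cmod c * r_lim X"
    "r_lim (\<lambda>n. X n \<boxplus> Y n) \<le> r_lim X + r_lim Y"
    "r_lim (\<lambda>n. X n \<boxtimes> Y n) \<le> r_lim X * r_lim Y"
    "r_lim (\<lambda>n. star (X n) \<boxtimes> X n) = (r_lim X)\<^sup>2"
proof -
  note lims = r_cauchy_tendsto[OF X] r_cauchy_tendsto[OF Y]
  show "0 \<le> r_lim X"
    by (rule LIMSEQ_le_const[OF lims(1)]) (use X in simp)
  show "r_lim (\<lambda>n. c \<odot> X n) = cmod c * r_lim X"
    using tendsto_mult_left[OF lims(1), of "cmod c"] X by (intro r_lim_eqI) (simp add: p_scale)
  show "r_lim (\<lambda>n. X n \<boxplus> Y n) \<le> r_lim X + r_lim Y"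
    by (rule LIMSEQ_le[OF r_cauchy_tendsto[OF r_cauchy_ops(1)[OF X Y]] tendsto_add[OF lims]])
      (use X Y in \<open>simp add: p_add\<close>)
  show "r_lim (\<lambda>n. X n \<boxtimes> Y n) \<le> r_lim X * r_lim Y"
    by (rule LIMSEQ_le[OF r_cauchy_tendsto[OF r_cauchy_ops(2)[OF X Y]] tendsto_mult[OF lims]])
      (use X Y in \<open>simp add: p_mul\<close>)
  show "r_lim (\<lambda>n. star (X n) \<boxtimes> X n) = (r_lim X)\<^sup>2"
    using tendsto_power[OF lims(1), of 2] X by (intro r_lim_eqI) (simp add: p_star_mul)
qed

text \<open>Density of the constant sequences: those with value \<open>X n\<close> approach
  \<open>X\<close> in the limit seminorm.\<close>

lemma r_lim_diff_tendsto:
  assumes X: "r_cauchy A X"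
  shows "(\<lambda>n. r_lim (\<lambda>m. X m \<boxminus> X n)) \<longlonglongrightarrow> 0"
proof (rule LIMSEQ_I)
  fix e :: real assume "0 < e"
  then obtain N where N: "\<forall>m\<ge>N. \<forall>n\<ge>N. r (X m \<boxminus> X n) < e / 2"
    using X unfolding r_cauchy_def by (meson half_gt_zero)
  have "norm (r_lim (\<lambda>m. X m \<boxminus> X n) - 0) < e" if "N \<le> n" for n
  proof -
    have c: "r_cauchy A (\<lambda>m. X m \<boxminus> X n)" using X by simp
    have "r_lim (\<lambda>m. X m \<boxminus> X n) \<le> e / 2"
      using N that by (intro LIMSEQ_le_const2[OF r_cauchy_tendsto[OF c]]) (auto intro: less_imp_le)
    then show ?thesis using r_lim_cstar(1)[OF c c] \<open>0 < e\<close> by simp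
  qed
  then show "\<exists>N. \<forall>n\<ge>N. norm (r_lim (\<lambda>m. X m \<boxminus> X n) - 0) < e" by blast
qed

end

text \<open>The algebra of Cauchy sequences, encoded by \<open>f\<close>, stands in for the completion: topological
  *-algebras need not be Hausdorff, so null sequences need not be divided out.\<close>
locale cauchy_alg = gsa A for A :: "'a tsalg" +
  fixes f :: "(nat \<Rightarrow> 'a) \<Rightarrow> 'c"
  assumes inj: "inj f"
begin

text \<open>The operations on sequences are transported along \<open>f\<close>. The topology is left
  open because \<open>seminorm_topology\<close> refers to this algebraic structure; \<open>E\<close>
  fills it in.\<close>

definition E0 :: "'c tsalg" where
  "E0 = \<lparr> sa_carrier = f ` Collect (r_cauchy A),
     sa_add = (\<lambda>u v. f (\<lambda>n. inv f u n \<boxplus> inv f v n)),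
     sa_mul = (\<lambda>u v. f (\<lambda>n. inv f u n \<boxtimes> inv f v n)),
     sa_smul = (\<lambda>c u. f (\<lambda>n. c \<odot> inv f u n)),
     sa_zero = f (\<lambda>n. zero),
     sa_star = (\<lambda>u. f (\<lambda>n. star (inv f u n))),
     sa_top = undefined \<rparr>"

definition E_norm :: "'c \<Rightarrow> real" where
  "E_norm u = (if u \<in> f ` Collect (r_cauchy A) then r_lim (inv f u) else 0)"

definition E :: "'c tsalg" where
  "E = E0\<lparr>sa_top := seminormed_star_alg.seminorm_topology E0 E_norm\<rparr>"

lemma inv_f [simp]: "inv f (f X) = X"
  using inj by simp

lemma f_eq_iff [simp]: "f X = f Y \<longleftrightarrow> X = Y"
  using inj by (rule inj_eq)

lemma E0_simps [simp]:
  "sa_carrier E0 = f ` Collect (r_cauchy A)"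
  "sa_add E0 (f X) (f Y) = f (\<lambda>n. X n \<boxplus> Y n)"
  "sa_mul E0 (f X) (f Y) = f (\<lambda>n. X n \<boxtimes> Y n)"
  "sa_smul E0 c (f X) = f (\<lambda>n. c \<odot> X n)"
  "sa_zero E0 = f (\<lambda>n. zero)"
  "sa_star E0 (f X) = f (\<lambda>n. star (X n))"
  by (simp_all add: E0_def)

lemma E_simps [simp]:
  "sa_carrier E = sa_carrier E0" "sa_add E = sa_add E0" "sa_mul E = sa_mul E0"
  "sa_smul E = sa_smul E0" "sa_zero E = sa_zero E0" "sa_star E = sa_star E0"
  "sa_diff E = sa_diff E0"
  by (simp_all add: E_def sa_diff_def sa_neg_def fun_eq_iff)

lemma E_norm_f [simp]: "r_cauchy A X \<Longrightarrow> E_norm (f X) = r_lim X"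
  by (simp add: E_norm_def)

lemma E_diff: "sa_diff E0 (f X) (f Y) = f (\<lambda>n. X n \<boxminus> Y n)"
  by (simp add: sa_diff_def[of E0] sa_neg_def[of E0] diff_eq)

lemma star_algebra_E0: "star_algebra E0"
  unfolding star_algebra_def Let_def
  by (auto simp: add_ac add_neg scale_add_right scale_add_left mul_assoc mul_add add_mul
      scale_mul mul_scale star_add star_scale star_mul)

sublocale E0: seminormed_star_alg E0 E_norm
proof
  show "star_algebra E0" by (rule star_algebra_E0)
  show "cstar_seminorm E0 E_norm"
    unfolding cstar_seminorm_def by (auto simp: r_lim_cstar)
qed

sublocale E: seminormed_star_alg E E_norm
proof
  show "star_algebra E"
    using star_algebra_E0 by (simp only: star_algebra_def E_simps)
  show "cstar_seminorm E E_norm"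
    using E0.seminorm by (simp only: cstar_seminorm_def E_simps)
qed

lemma E_top: "sa_top E = E.seminorm_topology"
proof -
  have "sa_top E = E0.seminorm_topology" by (simp add: E_def)
  also have "\<dots> = E.seminorm_topology"
    by (simp add: E0.seminorm_topology_def E.seminorm_topology_def)
  finally show ?thesis .
qed

text \<open>The embedding of constants is isometric for \<open>r\<close> and \<open>E_norm\<close>,
  and \<open>r\<close>-balls are open in \<open>A\<close>.\<close>

lemma continuous_map_const: "continuous_map (sa_top A) (sa_top E) (\<lambda>a. f (\<lambda>n. a))"
  unfolding E_top
proof (rule E.continuous_map_seminorm_topologyI)
  fix a e assume a: "a \<in> topspace (sa_top A)" and e: "0 < (e::real)"
  show "\<exists>V. openin (sa_top A) V \<and> a \<in> V \<and>
      (\<forall>y\<in>V. E_norm (sa_diff E (f (\<lambda>n. y)) (f (\<lambda>n. a))) < e)"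
    using a e by (intro exI[of _ "{x \<in> carr. r (x \<boxminus> a) < e}"]) (auto simp: openin_ball E_diff)
qed auto

lemma restrict_const_mem:
  assumes "p \<in> cont_cstar_seminorms E"
  shows "(\<lambda>a. if a \<in> carr then p (f (\<lambda>n. a)) else 0) \<in> cont_cstar_seminorms A" (is "?q \<in> _")
proof -
  interpret p: seminormed_star_alg E p
    by unfold_locales (use assms in \<open>simp add: cont_cstar_seminorms_def\<close>)
  have "cstar_seminorm A (\<lambda>a. p (f (\<lambda>n. a)))"
    using p.p_scale[of "f (\<lambda>n. _)"] p.p_add[of "f (\<lambda>n. _)" "f (\<lambda>n. _)"]
      p.p_mul[of "f (\<lambda>n. _)" "f (\<lambda>n. _)"] p.p_star_mul[of "f (\<lambda>n. _)"]
    by (auto simp: cstar_seminorm_def)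
  then have "cstar_seminorm A ?q"
    by (subst (asm) cstar_seminorm_cong[where q = ?q]) auto
  moreover have "continuous_map (sa_top A) euclideanreal (p \<circ> (\<lambda>a. f (\<lambda>n. a)))"
    using assms
    by (intro continuous_map_compose[OF continuous_map_const]) (simp add: cont_cstar_seminorms_def)
  then have "continuous_map (sa_top A) euclideanreal ?q"
    by (rule continuous_map_eq) simp
  ultimately show ?thesis by (simp add: cont_cstar_seminorms_def)
qed

lemma E_norm_mem: "E_norm \<in> cont_cstar_seminorms E"
  using E.seminorm E.continuous_map_seminorm E_top
  by (simp add: cont_cstar_seminorms_def E_norm_def)

text \<open>On constants \<open>p\<close> is at most \<open>r\<close>, since its pullback to
  \<open>A\<close> is a continuous C*-seminorm. Density of constants extends this to all of
  \<open>E\<close>: the unknown factor \<open>K\<close> from continuity multiplies a null sequence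
  and disappears in the limit.\<close>

lemma seminorm_le_E_norm:
  assumes p: "p \<in> cont_cstar_seminorms E"
  shows "p u \<le> E_norm u"
proof (cases "u \<in> E.carr")
  case True
  then obtain X where u: "u = f X" and X: "r_cauchy A X" by auto
  interpret p: seminormed_star_alg E p
    by unfold_locales (use p in \<open>simp add: cont_cstar_seminorms_def\<close>)
  obtain K where K: "\<And>v. v \<in> E.carr \<Longrightarrow> p v \<le> K * E_norm v"
    using E.continuous_seminorm_bounded[of p] p E_top by (auto simp: cont_cstar_seminorms_def)
  have "p (f X) \<le> r (X n) + K * r_lim (\<lambda>m. X m \<boxminus> X n)" for n
  proof -
    have "p (f X) \<le> p (f (\<lambda>m. X n)) + p (f (\<lambda>m. X m \<boxminus> X n))"
      using p.p_le_add_diff[of "f X" "f (\<lambda>m. X n)"] X by (simp add: E_diff)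
    moreover have "p (f (\<lambda>m. X n)) \<le> r (X n)"
      using le_r[OF restrict_const_mem[OF p], of "X n"] X by simp
    moreover have "p (f (\<lambda>m. X m \<boxminus> X n)) \<le> K * r_lim (\<lambda>m. X m \<boxminus> X n)"
      using K[of "f (\<lambda>m. X m \<boxminus> X n)"] X by simp
    ultimately show ?thesis by linarith
  qed
  moreover have "(\<lambda>n. r (X n) + K * r_lim (\<lambda>m. X m \<boxminus> X n)) \<longlonglongrightarrow> r_lim X + K * 0"
    by (intro tendsto_intros r_cauchy_tendsto r_lim_diff_tendsto X)
  ultimately have "p (f X) \<le> r_lim X + K * 0"
    by (intro LIMSEQ_le_const) auto
  then show ?thesis using X u by simp
next
  case False
  then show ?thesis using p by (auto simp: cont_cstar_seminorms_def E_norm_def)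
qed

lemma is_largest_E_norm: "is_largest_seminorm E E_norm"
  using E_norm_mem seminorm_le_E_norm by (simp add: is_largest_seminorm_def)

lemma in_GsA_E: "in_GsA E"
  using E.top_star_algebra_seminorm[OF E_top] is_largest_E_norm by (auto simp: in_GsA_def)

sublocale AE: gsa_pair A E
  by unfold_locales (rule in_GsA_E)

lemma E_r: "AE.B.r = E_norm"
  using AE.B.is_largest is_largest_E_norm
  by (auto simp: is_largest_seminorm_def fun_eq_iff intro!: order_antisym)

definition graph :: "('a \<times> 'c) set" where
  "graph = (\<lambda>a. (a, f (\<lambda>n. a))) ` carr"

lemma star_subalgebra_graph: "star_subalgebra AE.AB graph"
  unfolding star_subalgebra_def graph_def by (auto intro!: imageI)

text \<open>By density \<open>f X\<close> lies in the closure of the image of the graph. The assumed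
  equality supplies \<open>a\<close> with \<open>(a, f X)\<close> in the closure of the graph, and
  this \<open>a\<close> is a limit of \<open>X\<close>.\<close>

lemma complete_if_snd_closure:
  assumes eq: "snd ` cstar_closure AE.AB graph = cstar_closure E (snd ` graph)"
    and X: "r_cauchy A X"
  shows "\<exists>a\<in>carr. (\<lambda>n. r (X n \<boxminus> a)) \<longlonglongrightarrow> 0"
proof -
  have sub: "graph \<subseteq> AE.AB.carr" "snd ` graph \<subseteq> E.carr" by (auto simp: graph_def)
  have "\<exists>u\<in>snd ` graph. E_norm (sa_diff E u (f X)) < e" if "0 < e" for e
  proof -
    have "\<forall>\<^sub>F n in sequentially. r_lim (\<lambda>m. X m \<boxminus> X n) < e"
      using r_lim_diff_tendsto[OF X] that by (rule order_tendstoD)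
    then obtain n where n: "r_lim (\<lambda>m. X m \<boxminus> X n) < e" by (auto dest: eventually_happens)
    have "E_norm (sa_diff E (f (\<lambda>m. X n)) (f X)) = E_norm (sa_diff E (f X) (f (\<lambda>m. X n)))"
      using X by (intro E.p_diff_commute) auto
    then have "E_norm (sa_diff E (f (\<lambda>m. X n)) (f X)) < e" using n X by (simp add: E_diff)
    then show ?thesis using X by (force simp: graph_def)
  qed
  then have "f X \<in> cstar_closure E (snd ` graph)"
    using X unfolding AE.B.cstar_closure_r[OF sub(2)] E_r by auto
  then obtain a where "(a, f X) \<in> cstar_closure AE.AB graph" unfolding eq[symmetric] by auto
  then have a: "a \<in> carr"
    and close: "\<And>e. 0 < e \<Longrightarrow> \<exists>(a', b')\<in>graph. r (a' \<boxminus> a) < e \<and> E_norm (sa_diff E b' (f X)) < e"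
    unfolding AE.cstar_closure_prod_iff[OF sub(1)] E_r by auto
  have "(\<lambda>n. r (X n \<boxminus> a)) \<longlonglongrightarrow> 0"
  proof (rule LIMSEQ_I)
    fix e :: real assume "0 < e"
    \<comment> \<open>A graph point close to \<open>(a, f X)\<close> gives one \<open>a'\<close>
      that is near \<open>a\<close> and also near \<open>X n\<close> for all large
      \<open>n\<close>.\<close>
    then obtain a' where a': "a' \<in> carr" "r (a' \<boxminus> a) < e / 2"
      and "E_norm (sa_diff E (f (\<lambda>n. a')) (f X)) < e / 2"
      using close[of "e / 2"] by (auto simp: graph_def)
    then have "r_lim (\<lambda>n. a' \<boxminus> X n) < e / 2" using X by (simp add: E_diff)
    then have "\<forall>\<^sub>F n in sequentially. r (a' \<boxminus> X n) < e / 2"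
      using a'(1) X by (intro order_tendstoD(2)[OF r_cauchy_tendsto]) auto
    then have "\<forall>\<^sub>F n in sequentially. norm (r (X n \<boxminus> a) - 0) < e"
    proof (rule eventually_mono)
      fix n assume "r (a' \<boxminus> X n) < e / 2"
      then show "norm (r (X n \<boxminus> a) - 0) < e"
        using p_diff_triangle[of "X n" a' a] p_diff_commute[of "X n" a'] a a' X by simp
    qed
    then show "\<exists>N. \<forall>n\<ge>N. norm (r (X n \<boxminus> a) - 0) < e" by (simp add: eventually_sequentially)
  qed
  with a show ?thesis by blast
qed

end

section \<open>The equivalence of compactness and surjectivity\<close>

theorem theorem5p6:
  fixes A :: "'a tsalg"
  assumes "in_GsA A"
  shows "(envelope_map A ` sa_carrier A = envelope_carrier A \<longrightarrow> cstar_compact TYPE('b) A)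
       \<and> ((\<exists>f :: (nat \<Rightarrow> 'a) \<Rightarrow> 'c. inj f) \<longrightarrow> cstar_compact TYPE('c) A
            \<longrightarrow> envelope_map A ` sa_carrier A = envelope_carrier A)"
proof (intro conjI impI)
  interpret A: gsa A by unfold_locales fact
  assume surj: "envelope_map A ` sa_carrier A = envelope_carrier A"
  show "cstar_compact TYPE('b) A"
    unfolding cstar_compact_def
  proof (intro conjI allI impI assms)
    fix B :: "'b tsalg" and S assume B: "in_GsA B" and S: "star_subalgebra (sa_prod A B) S"
    interpret gsa_pair A B by unfold_locales fact
    show "snd ` cstar_closure (sa_prod A B) S = cstar_closure B (snd ` S)"
      using surj S unfolding A.envelope_map_surj_iff by (intro snd_cstar_closure) auto
  qed
next
  interpret A: gsa A by unfold_locales fact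
  assume "\<exists>f :: (nat \<Rightarrow> 'a) \<Rightarrow> 'c. inj f" and compact: "cstar_compact TYPE('c) A"
  then obtain f :: "(nat \<Rightarrow> 'a) \<Rightarrow> 'c" where "inj f" by blast
  \<comment> \<open>Compactness tests only algebras over the type \<open>'c\<close>; the injection
    \<open>f\<close> places the algebra of Cauchy sequences there.\<close>
  then interpret cauchy_alg A f by unfold_locales
  have "snd ` cstar_closure AE.AB graph = cstar_closure E (snd ` graph)"
    using compact in_GsA_E star_subalgebra_graph unfolding cstar_compact_def by blast
  then show "envelope_map A ` sa_carrier A = envelope_carrier A"
    unfolding A.envelope_map_surj_iff using complete_if_snd_closure by blast
qed

end
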